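(* For a $C^2(\overline\Omega)$ transonic flow of Meyer type in the symmetric de Laval nozzle $\Omega$ (described in the context), the following statements are equivalent: (i) the endpoint of the sonic curve on the wall is located at the throat point $(0,f(0))$; (ii) the flow angle always equals zero at the sonic curve; (iii) every point at the sonic curve is exceptional; (iv) the velocity vector is along the normal direction at the sonic curve; (v) the potential is a constant at the sonic curve; (vi) the sonic curve is located at the throat of the nozzle (i.e. it is the segment $\{0\}\times[0,f(0)]$).
   Context: Gas law: $\gamma>1$, $\rho(q^2)=\big(1-\frac{\gamma-1}2q^2\big)^{1/(\gamma-1)}$ for $0<q<q_{max}=(2/(\gamma-1))^{1/2}$, $c_*=(2/(\gamma+1))^{1/2}$. Nozzle: $l_-<0<l_+$, $f\in C^1([l_-,l_+])$ positive with $f'<0$ on $[l_-,0)$, $f'(0)=0$, $f'>0$ on $(0,l_+]$. $\Omega$ is the domain bounded by the upper wall $y=f(x)$ ($l_-\le x\le l_+$), the $x$-axis, an inlet $x=g(y)$ ($0\le y\le f(l_-)$) and an outlet $x=t(y)$ ($0\le y\le f(l_+)$); it is the upper half of a nozzle symmetric with respect to the $x$-axis, whose throat is at $x=0$. A flow in $\Omega$ is a velocity field $(u,v)=q(\cos\theta,\sin\theta)$, $0<q<q_{max}$, with $(\rho u)_x+(\rho v)_y=0$, $u_y=v_x$, $\rho=\rho(u^2+v^2)$, satisfying the slip condition on the upper wall (velocity tangent to $y=f(x)$) and, by symmetry, $v=0$ on the $x$-axis; $\theta$ is the flow angle and the potential $\varphi$ satisfies $\nabla\varphi=(u,v)$.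 The regularity refers to the velocity. The flow is subsonic, sonic, supersonic where $q<c_*$, $q=c_*$, $q>c_*$. It is transonic if it has both subsonic and supersonic regions; the sonic curve ($q=c_*$) is a regular $C^2$ curve assumed to lie in the boundary of both regions. Meyer type: the sonic curve extends from one wall of the nozzle to the other (in $\Omega$: from the $x$-axis to the upper wall), separating the subsonic from the supersonic region. A point of the sonic curve is exceptional if the derivative of $\theta$ with respect to arc length along the sonic curve vanishes there. *)

theory Defs
  imports "HOL-Analysis.Analysis"
begin

section \<open>Gas law\<close>

definition density :: "real \<Rightarrow> real \<Rightarrow> real" where
  "density \<gamma> s = (1 - (\<gamma> - 1) / 2 * s) powr (1 / (\<gamma> - 1))"

definition q_max :: "real \<Rightarrow> real" where
  "q_max \<gamma> = sqrt (2 / (\<gamma> - 1))"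

definition c_star :: "real \<Rightarrow> real" where
  "c_star \<gamma> = sqrt (2 / (\<gamma> + 1))"


section \<open>The upper half of a symmetric de Laval nozzle\<close>

definition upper_wall :: "real \<Rightarrow> real \<Rightarrow> (real \<Rightarrow> real) \<Rightarrow> (real \<times> real) set" where
  "upper_wall lm lp f = (\<lambda>x. (x, f x)) ` {lm..lp}"

definition axis_wall :: "(real \<Rightarrow> real) \<Rightarrow> (real \<Rightarrow> real) \<Rightarrow> (real \<times> real) set" where
  "axis_wall g t = (\<lambda>x. (x, 0)) ` {g 0..t 0}"

definition inlet :: "real \<Rightarrow> (real \<Rightarrow> real) \<Rightarrow> (real \<Rightarrow> real) \<Rightarrow> (real \<times> real) set" where
  "inlet lm f g = (\<lambda>y. (g y, y)) ` {0..f lm}"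

definition outlet :: "real \<Rightarrow> (real \<Rightarrow> real) \<Rightarrow> (real \<Rightarrow> real) \<Rightarrow> (real \<times> real) set" where
  "outlet lp f t = (\<lambda>y. (t y, y)) ` {0..f lp}"

text \<open>
  The domain bounded by the four arcs. Under the conditions of \<open>de_laval_nozzle\<close> their union
  is a Jordan curve, so its inside is a simply connected domain.
\<close>

definition nozzle_domain ::
  "real \<Rightarrow> real \<Rightarrow> (real \<Rightarrow> real) \<Rightarrow> (real \<Rightarrow> real) \<Rightarrow> (real \<Rightarrow> real) \<Rightarrow> (real \<times> real) set" where
  "nozzle_domain lm lp f g t =
     inside (upper_wall lm lp f \<union> axis_wall g t \<union> inlet lm f g \<union> outlet lp f t)"

text \<open>
  \<open>f'\<close> is the derivative of \<open>f\<close> on \<open>[lm, lp]\<close>, one-sided at the endpoints. The last two lines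
  say that consecutive arcs share exactly their common corner and that there are no other
  intersections; the corners on the axis need no condition because inlet and outlet are graphs
  over the \<open>y\<close>-axis.
\<close>

definition de_laval_nozzle ::
  "real \<Rightarrow> real \<Rightarrow> (real \<Rightarrow> real) \<Rightarrow> (real \<Rightarrow> real) \<Rightarrow> (real \<Rightarrow> real) \<Rightarrow> (real \<Rightarrow> real) \<Rightarrow> bool" where
  "de_laval_nozzle lm lp f f' g t \<longleftrightarrow>
     lm < 0 \<and> 0 < lp \<and>
     (\<forall>x\<in>{lm..lp}. 0 < f x) \<and>
     (\<forall>x\<in>{lm..lp}. (f has_real_derivative f' x) (at x within {lm..lp})) \<and>
     continuous_on {lm..lp} f' \<and>
     (\<forall>x\<in>{lm..<0}. f' x < 0) \<and> f' 0 = 0 \<and> (\<forall>x\<in>{0<..lp}. 0 < f' x) \<and>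
     continuous_on {0..f lm} g \<and> continuous_on {0..f lp} t \<and>
     g (f lm) = lm \<and> t (f lp) = lp \<and> g 0 < t 0 \<and>
     inlet lm f g \<inter> upper_wall lm lp f = {(lm, f lm)} \<and>
     outlet lp f t \<inter> upper_wall lm lp f = {(lp, f lp)} \<and>
     inlet lm f g \<inter> outlet lp f t = {}"


section \<open>Flows\<close>

text \<open>
  \<open>Ck_closure k \<Omega> h\<close>: the function \<open>h\<close> is of class \<open>C\<^sup>k\<close> on the closure of the open set \<open>\<Omega>\<close>, i.e. its
  partial derivatives in \<open>\<Omega>\<close> up to order \<open>k\<close> extend continuously to the closure.
\<close>

primrec Ck_closure :: "nat \<Rightarrow> (real \<times> real) set \<Rightarrow> (real \<times> real \<Rightarrow> real) \<Rightarrow> bool" where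
  "Ck_closure 0 \<Omega> h \<longleftrightarrow> continuous_on (closure \<Omega>) h"
| "Ck_closure (Suc k) \<Omega> h \<longleftrightarrow> continuous_on (closure \<Omega>) h \<and>
     (\<exists>hx hy. Ck_closure k \<Omega> hx \<and> Ck_closure k \<Omega> hy \<and>
        (\<forall>p\<in>\<Omega>. GDERIV h p :> (hx p, hy p)))"

definition partial_x :: "(real \<times> real \<Rightarrow> real) \<Rightarrow> real \<times> real \<Rightarrow> real" where
  "partial_x h p = deriv (\<lambda>x. h (x, snd p)) (fst p)"

definition partial_y :: "(real \<times> real \<Rightarrow> real) \<Rightarrow> real \<times> real \<Rightarrow> real" where
  "partial_y h p = deriv (\<lambda>y. h (fst p, y)) (snd p)"

definition speed :: "(real \<times> real \<Rightarrow> real) \<Rightarrow> (real \<times> real \<Rightarrow> real) \<Rightarrow> real \<times> real \<Rightarrow> real" where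
  "speed u v p = sqrt ((u p)\<^sup>2 + (v p)\<^sup>2)"

definition C2_potential_flow ::
  "real \<Rightarrow> (real \<times> real) set \<Rightarrow> (real \<times> real \<Rightarrow> real) \<Rightarrow> (real \<times> real \<Rightarrow> real) \<Rightarrow> bool" where
  "C2_potential_flow \<gamma> \<Omega> u v \<longleftrightarrow>
     Ck_closure 2 \<Omega> u \<and> Ck_closure 2 \<Omega> v \<and>
     (\<forall>p\<in>closure \<Omega>. 0 < speed u v p \<and> speed u v p < q_max \<gamma>) \<and>
     (\<forall>p\<in>\<Omega>. partial_x (\<lambda>z. density \<gamma> ((u z)\<^sup>2 + (v z)\<^sup>2) * u z) p
            + partial_y (\<lambda>z. density \<gamma> ((u z)\<^sup>2 + (v z)\<^sup>2) * v z) p = 0) \<and>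
     (\<forall>p\<in>\<Omega>. partial_y u p = partial_x v p)"

definition slip_condition ::
  "real \<Rightarrow> real \<Rightarrow> (real \<Rightarrow> real) \<Rightarrow> (real \<Rightarrow> real) \<Rightarrow> (real \<Rightarrow> real) \<Rightarrow> (real \<Rightarrow> real)
     \<Rightarrow> (real \<times> real \<Rightarrow> real) \<Rightarrow> (real \<times> real \<Rightarrow> real) \<Rightarrow> bool" where
  "slip_condition lm lp f f' g t u v \<longleftrightarrow>
     (\<forall>x\<in>{lm..lp}. v (x, f x) = f' x * u (x, f x)) \<and>
     (\<forall>p\<in>axis_wall g t. v p = 0)"

text \<open>
  The angle of the velocity is only determined modulo \<open>2\<pi>\<close>. The flow angle is the continuous
  branch for which the gas runs along both walls \<open>B\<close> from the inlet to the outlet; together with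
  \<open>slip_condition\<close> the last line means \<open>\<theta> = 0\<close> on the axis and \<open>\<theta> = arctan f'\<close> on the upper wall.
\<close>

definition flow_angle ::
  "(real \<times> real) set \<Rightarrow> (real \<times> real) set \<Rightarrow> (real \<times> real \<Rightarrow> real) \<Rightarrow> (real \<times> real \<Rightarrow> real)
     \<Rightarrow> (real \<times> real \<Rightarrow> real) \<Rightarrow> bool" where
  "flow_angle \<Omega> B u v \<theta> \<longleftrightarrow>
     continuous_on (closure \<Omega>) \<theta> \<and>
     (\<forall>p\<in>closure \<Omega>. (u p, v p) = speed u v p *\<^sub>R (cos (\<theta> p), sin (\<theta> p))) \<and>
     (\<forall>p\<in>B. \<bar>\<theta> p\<bar> < pi / 2)"

definition velocity_potential ::
  "(real \<times> real) set \<Rightarrow> (real \<times> real \<Rightarrow> real) \<Rightarrow> (real \<times> real \<Rightarrow> real) \<Rightarrow> (real \<times> real \<Rightarrow> real) \<Rightarrow> bool" where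
  "velocity_potential \<Omega> u v \<phi> \<longleftrightarrow>
     continuous_on (closure \<Omega>) \<phi> \<and> (\<forall>p\<in>\<Omega>. GDERIV \<phi> p :> (u p, v p))"


section \<open>Transonic flows of Meyer type\<close>

definition subsonic_region ::
  "real \<Rightarrow> (real \<times> real) set \<Rightarrow> (real \<times> real \<Rightarrow> real) \<Rightarrow> (real \<times> real \<Rightarrow> real) \<Rightarrow> (real \<times> real) set" where
  "subsonic_region \<gamma> \<Omega> u v = {p \<in> \<Omega>. speed u v p < c_star \<gamma>}"

definition sonic_set ::
  "real \<Rightarrow> (real \<times> real) set \<Rightarrow> (real \<times> real \<Rightarrow> real) \<Rightarrow> (real \<times> real \<Rightarrow> real) \<Rightarrow> (real \<times> real) set" where
  "sonic_set \<gamma> \<Omega> u v = {p \<in> \<Omega>. speed u v p = c_star \<gamma>}"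

definition supersonic_region ::
  "real \<Rightarrow> (real \<times> real) set \<Rightarrow> (real \<times> real \<Rightarrow> real) \<Rightarrow> (real \<times> real \<Rightarrow> real) \<Rightarrow> (real \<times> real) set" where
  "supersonic_region \<gamma> \<Omega> u v = {p \<in> \<Omega>. speed u v p > c_star \<gamma>}"

text \<open>
  A simple regular \<open>C\<^sup>2\<close> curve of length \<open>L\<close>, parametrised by arc length on \<open>[0, L]\<close>
  (derivatives are one-sided at \<open>0\<close> and \<open>L\<close>).
\<close>

definition regular_C2_arc :: "(real \<Rightarrow> real \<times> real) \<Rightarrow> real \<Rightarrow> bool" where
  "regular_C2_arc \<sigma> L \<longleftrightarrow> 0 < L \<and> inj_on \<sigma> {0..L} \<and>
     (\<exists>\<sigma>' \<sigma>''. (\<forall>s\<in>{0..L}. (\<sigma> has_vector_derivative \<sigma>' s) (at s within {0..L}) \<and>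
                             (\<sigma>' has_vector_derivative \<sigma>'' s) (at s within {0..L}) \<and>
                             norm (\<sigma>' s) = 1) \<and>
             continuous_on {0..L} \<sigma>'')"

text \<open>
  The sonic curve \<open>\<sigma>\<close> is oriented from the axis (\<open>s = 0\<close>) to the upper wall (\<open>s = L\<close>). Its
  relative interior is the set of sonic points of \<open>\<Omega>\<close>; its endpoints lie on the boundary of \<open>\<Omega>\<close>.
\<close>

definition meyer_sonic_curve ::
  "real \<Rightarrow> real \<Rightarrow> real \<Rightarrow> (real \<Rightarrow> real) \<Rightarrow> (real \<Rightarrow> real) \<Rightarrow> (real \<Rightarrow> real)
     \<Rightarrow> (real \<times> real \<Rightarrow> real) \<Rightarrow> (real \<times> real \<Rightarrow> real) \<Rightarrow> (real \<Rightarrow> real \<times> real) \<Rightarrow> real \<Rightarrow> bool" where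
  "meyer_sonic_curve \<gamma> lm lp f g t u v \<sigma> L \<longleftrightarrow>
     (let \<Omega> = nozzle_domain lm lp f g t;
          Sm = subsonic_region \<gamma> \<Omega> u v;
          Sp = supersonic_region \<gamma> \<Omega> u v
      in Sm \<noteq> {} \<and> Sp \<noteq> {} \<and>
         regular_C2_arc \<sigma> L \<and>
         \<sigma> 0 \<in> axis_wall g t \<and> \<sigma> L \<in> upper_wall lm lp f \<and>
         \<sigma> ` {0<..<L} = sonic_set \<gamma> \<Omega> u v \<and>
         \<sigma> ` {0..L} \<subseteq> frontier Sm \<inter> frontier Sp \<and>
         components (\<Omega> - \<sigma> ` {0..L}) = {Sm, Sp})"

definition exceptional_point ::
  "(real \<times> real \<Rightarrow> real) \<Rightarrow> (real \<Rightarrow> real \<times> real) \<Rightarrow> real \<Rightarrow> real \<Rightarrow> bool" where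
  "exceptional_point \<theta> \<sigma> L s \<longleftrightarrow>
     ((\<lambda>r. \<theta> (\<sigma> r)) has_real_derivative 0) (at s within {0..L})"

definition unit_normal :: "(real \<Rightarrow> real \<times> real) \<Rightarrow> real \<Rightarrow> real \<Rightarrow> real \<times> real" where
  "unit_normal \<sigma> L s =
     (let \<tau> = vector_derivative \<sigma> (at s within {0..L}) in (- snd \<tau>, fst \<tau>))"

end

theory Submission
  imports Defs
begin

text \<open>
  Write \<open>\<sigma>\<close> for the sonic curve, parametrised by arc length from the axis to the upper wall, \<open>\<tau>\<close> for
  its unit tangent, and \<open>\<nu>\<close> for its left normal. Two facts about the curve carry all the
  equivalences.

  The first is the monotonicity law of Nikolskii and Taganov. At a sonic point the equation of
  motion degenerates: it says that \<open>\<nabla>\<theta>\<close> is parallel to the velocity \<open>w = (u, v)\<close>. Together with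
  irrotationality and \<open>\<nabla>q \<bullet> \<tau> = 0\<close> this gives, for the derivative of the flow angle along the curve,
  \<open>q\<^sup>4 d\<theta>/ds = (1/2) (\<nabla>q\<^sup>2 \<bullet> \<nu>) (w \<bullet> \<tau>)\<^sup>2\<close>.
  The normal derivative of \<open>q\<^sup>2\<close> cannot change sign along the curve, because the supersonic region
  lies on the same side of the curve all the way. Hence \<open>\<theta>\<close> is monotone along \<open>\<sigma>\<close>
  (\<open>angle_derivative\<close>, \<open>side_rate_sign\<close>). On the axis \<open>\<theta> = 0\<close>; at the end on the wall \<open>\<theta> = arctan f'\<close>,
  which vanishes exactly at the throat. So the curve ends at the throat iff \<open>\<theta>\<close> vanishes identically
  on it, which gives (i) iff (ii), and (ii) iff (iii) since \<open>\<theta> = 0\<close> at the start. If the velocity is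
  normal to the curve, then \<open>w \<bullet> \<tau> = 0\<close>, so \<open>\<theta>\<close> is constant on it: (iv) implies (ii). As
  \<open>w \<bullet> \<tau>\<close> is the derivative of the potential along \<open>\<sigma>\<close>, (iv) iff (v).

  The second fact gives (ii) implies (iv). If \<open>\<theta> = 0\<close> on the curve, the formula only says that
  the normal derivative of \<open>q\<^sup>2\<close> or \<open>w \<bullet> \<tau>\<close> vanishes, and the first possibility has to be excluded
  where \<open>w \<bullet> \<tau>\<close> is nonzero. Differentiating the equation of motion shows that \<open>u\<close> solves a linear
  equation \<open>u\<^sub>y\<^sub>y + a u\<^sub>x\<^sub>x + b u\<^sub>x\<^sub>y + b\<^sub>1 u\<^sub>x + b\<^sub>2 u\<^sub>y = 0\<close>, elliptic in the subsonic region and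
  degenerate at the sonic point, where \<open>a = b = 0\<close>. The direction that survives the degeneration
  is the vertical one, and it is transversal to the curve unless the tangent is vertical. This is
  enough for a Hopf boundary point lemma (\<open>hopf_lemma_parabola\<close>): at a sonic point where \<open>v = 0\<close> and
  where the tangent is not vertical, \<open>u\<^sub>y\<close> is nonzero. But \<open>u = c\<^sub>*\<close> and \<open>v = 0\<close> along the whole curve
  force \<open>u\<^sub>y = 0\<close> there. So the tangent is vertical everywhere, that is, the curve is normal to the
  horizontal velocity. A curve with vertical tangent that ends at the throat is the segment of (vi).
\<close>

section \<open>Calculus of functions of two real variables\<close>

lemma GDERIV_along_curve:
  assumes "GDERIV h (c s) :> D" and "(c has_vector_derivative c') (at s within T)"
  shows "((\<lambda>r. h (c r)) has_real_derivative D \<bullet> c') (at s within T)"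
proof -
  have "((\<lambda>r. h (c r)) has_derivative (\<lambda>d. (d *\<^sub>R c') \<bullet> D)) (at s within T)"
    using assms unfolding gderiv_def has_vector_derivative_def
    by (rule has_derivative_compose[rotated])
  moreover have "(\<lambda>d. (d *\<^sub>R c') \<bullet> D) = (*) (D \<bullet> c')"
    by (auto simp: inner_commute mult.commute)
  ultimately show ?thesis by (simp add: has_field_derivative_def)
qed

lemma GDERIV_along_line:
  assumes "GDERIV h (p + s *\<^sub>R e) :> D"
  shows "((\<lambda>r. h (p + r *\<^sub>R e)) has_real_derivative D \<bullet> e) (at s)"
  by (rule GDERIV_along_curve[where c = "\<lambda>r. p + r *\<^sub>R e", OF assms])
     (auto intro!: derivative_eq_intros)

lemma GDERIV_unique_on_open:
  assumes "GDERIV h p :> D" "GDERIV k p :> E" "open S" "p \<in> S" "\<And>q. q \<in> S \<Longrightarrow> h q = k q"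
  shows "D = E"
proof -
  have "(k has_derivative (\<lambda>d. d \<bullet> D)) (at p)"
    using has_derivative_transform_within_open[OF assms(1)[unfolded gderiv_def] assms(3,4)] assms(5) by simp
  then have "(\<lambda>d. d \<bullet> D) = (\<lambda>d. d \<bullet> E)"
    using assms(2) unfolding gderiv_def by (rule has_derivative_unique)
  then have "(D - E) \<bullet> D = (D - E) \<bullet> E" by meson
  then have "(D - E) \<bullet> (D - E) = 0" by (simp add: inner_diff_right)
  then show ?thesis by simp
qed

lemma GDERIV_continuous_on:
  assumes "\<And>p. p \<in> S \<Longrightarrow> GDERIV h p :> D p"
  shows "continuous_on S h"
  using assms unfolding gderiv_def
  by (meson continuous_at_imp_continuous_on has_derivative_continuous)

lemma mixed_second_difference:
  fixes f :: "real \<times> real \<Rightarrow> real"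
  assumes f: "\<And>q. q \<in> {a..a+h} \<times> {b..b+h} \<Longrightarrow> GDERIV f q :> (fx q, fy q)"
    and fx: "\<And>q. q \<in> {a..a+h} \<times> {b..b+h} \<Longrightarrow> GDERIV fx q :> (fxx q, fxy q)"
    and h: "0 < h"
  obtains q where "q \<in> {a..a+h} \<times> {b..b+h}"
    "f (a+h, b+h) - f (a+h, b) - f (a, b+h) + f (a, b) = h\<^sup>2 * fxy q"
proof -
  have dx: "((\<lambda>x. f (x, y)) has_real_derivative fx (x, y)) (at x)"
    if "x \<in> {a..a+h}" "y \<in> {b..b+h}" for x y
    using GDERIV_along_line[of f "(0,y)" x "(1,0)" "(fx (x,y), fy (x,y))"] f[of "(x,y)"] that by simp
  have dy: "((\<lambda>y. fx (x, y)) has_real_derivative fxy (x, y)) (at y)"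
    if "x \<in> {a..a+h}" "y \<in> {b..b+h}" for x y
    using GDERIV_along_line[of fx "(x,0)" y "(0,1)" "(fxx (x,y), fxy (x,y))"] fx[of "(x,y)"] that by simp
  have "\<exists>z>a. z < a + h \<and> (f (a+h, b+h) - f (a+h, b)) - (f (a, b+h) - f (a, b))
          = (a + h - a) * (fx (z, b+h) - fx (z, b))"
    using h by (intro MVT2 derivative_intros dx) auto
  then obtain x where x: "a < x" "x < a + h"
    "(f (a+h, b+h) - f (a+h, b)) - (f (a, b+h) - f (a, b)) = h * (fx (x, b+h) - fx (x, b))"
    by auto
  have "\<exists>z>b. z < b + h \<and> fx (x, b+h) - fx (x, b) = (b + h - b) * fxy (x, z)"
    using h x by (intro MVT2 dy) auto
  then obtain y where y: "b < y" "y < b + h" "fx (x, b+h) - fx (x, b) = h * fxy (x, y)"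
    by auto
  show ?thesis
    by (rule that[of "(x,y)"]) (use x y in \<open>auto simp: power2_eq_square\<close>)
qed

text \<open>
  Schwarz's theorem. The mean value theorem, applied in either order, turns the same second
  difference over a small square into a value of one mixed partial derivative or of the other.
\<close>

lemma mixed_partials_eq:
  fixes f :: "real \<times> real \<Rightarrow> real"
  assumes S: "open S" "p \<in> S"
    and f: "\<And>q. q \<in> S \<Longrightarrow> GDERIV f q :> (fx q, fy q)"
    and fx: "\<And>q. q \<in> S \<Longrightarrow> GDERIV fx q :> (fxx q, fxy q)"
    and fy: "\<And>q. q \<in> S \<Longrightarrow> GDERIV fy q :> (fyx q, fyy q)"
    and cont: "continuous_on S fxy" "continuous_on S fyx"
  shows "fxy p = fyx p"
proof (rule ccontr)
  assume "fxy p \<noteq> fyx p"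
  define e where "e = \<bar>fxy p - fyx p\<bar> / 2"
  have e: "e > 0" using \<open>fxy p \<noteq> fyx p\<close> by (simp add: e_def)
  obtain d0 where d0: "d0 > 0" "ball p d0 \<subseteq> S"
    using S openE by blast
  have "isCont fxy p" "isCont fyx p"
    using cont S continuous_on_eq_continuous_at by blast+
  then obtain d1 d2 where d: "d1 > 0" "\<And>q. dist q p < d1 \<Longrightarrow> dist (fxy q) (fxy p) < e"
    "d2 > 0" "\<And>q. dist q p < d2 \<Longrightarrow> dist (fyx q) (fyx p) < e"
    using e unfolding continuous_at_eps_delta by metis
  define h where "h = min d0 (min d1 d2) / 3"
  have h: "h > 0" using d0 d by (simp add: h_def)
  obtain a b where p: "p = (a, b)" by (cases p)
  have near: "dist q p < min d0 (min d1 d2)" if "q \<in> {a..a+h} \<times> {b..b+h}" for q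
  proof -
    have "dist q p \<le> dist (fst q) a + dist (snd q) b"
      using sqrt_sum_squares_le_sum_abs[of "dist (fst q) a" "dist (snd q) b"]
      by (simp add: dist_prod_def p)
    also have "\<dots> \<le> 2 * h" using that by (auto simp: dist_real_def)
    also have "\<dots> < min d0 (min d1 d2)" using h unfolding h_def by linarith
    finally show ?thesis .
  qed
  have inS: "q \<in> S" if "q \<in> {a..a+h} \<times> {b..b+h}" for q
    using near[OF that] d0(2) by (metis dist_commute mem_ball min_less_iff_conj subsetD)
  obtain q1 where q1: "q1 \<in> {a..a+h} \<times> {b..b+h}"
    "f (a+h, b+h) - f (a+h, b) - f (a, b+h) + f (a, b) = h\<^sup>2 * fxy q1"
    by (rule mixed_second_difference[where f=f and fx=fx and fy=fy and fxx=fxx and fxy=fxy and a=a and b=b and h=h])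
       (use f fx inS h in blast)+
  let ?sw = "\<lambda>q::real\<times>real. (snd q, fst q)"
  have swap: "GDERIV (\<lambda>q. k (?sw q)) q :> (B, A)"
    if "GDERIV k (?sw q) :> (A, B)" for k :: "real \<times> real \<Rightarrow> real" and q A B
  proof -
    have "((\<lambda>q. k (?sw q)) has_derivative (\<lambda>d. (?sw d) \<bullet> (A, B))) (at q)"
      by (rule has_derivative_compose[of ?sw, OF _ that[unfolded gderiv_def]])
         (auto intro!: derivative_eq_intros)
    then show ?thesis by (simp add: gderiv_def inner_prod_def add.commute)
  qed
  obtain q2 where q2: "q2 \<in> {b..b+h} \<times> {a..a+h}"
    "f (a+h, b+h) - f (a, b+h) - f (a+h, b) + f (a, b) = h\<^sup>2 * fyx (?sw q2)"
  proof (rule mixed_second_difference[where f="\<lambda>q. f (?sw q)" and fx="\<lambda>q. fy (?sw q)"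
        and fy="\<lambda>q. fx (?sw q)" and fxx="\<lambda>q. fyy (?sw q)" and fxy="\<lambda>q. fyx (?sw q)" and a=b and b=a and h=h])
    fix q assume "q \<in> {b..b+h} \<times> {a..a+h}"
    then have *: "?sw q \<in> S" using inS[of "?sw q"] by auto
    show "GDERIV (\<lambda>q. f (?sw q)) q :> (fy (?sw q), fx (?sw q))" by (rule swap[OF f[OF *]])
    show "GDERIV (\<lambda>q. fy (?sw q)) q :> (fyy (?sw q), fyx (?sw q))" by (rule swap[OF fy[OF *]])
  qed (use h in auto)
  have "fxy q1 = fyx (?sw q2)"
    using q1(2) q2(2) h by (simp add: algebra_simps)
  moreover have "\<bar>fxy q1 - fxy p\<bar> < e" using d(2) near[OF q1(1)] by (simp add: dist_real_def)
  moreover have "\<bar>fyx (?sw q2) - fyx p\<bar> < e"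
    using d(4) near[of "?sw q2"] q2(1) by (auto simp: dist_real_def)
  ultimately show False unfolding e_def by (simp add: abs_if split: if_splits)
qed

lemma DERIV_second_at_local_max:
  fixes g g' :: "real \<Rightarrow> real"
  assumes d: "d > 0"
    and g: "\<And>t. \<bar>t - t0\<bar> < d \<Longrightarrow> (g has_real_derivative g' t) (at t)"
    and g': "(g' has_real_derivative g'') (at t0)"
    and max: "\<And>t. \<bar>t - t0\<bar> < d \<Longrightarrow> g t \<le> g t0"
  shows "g' t0 = 0" and "g'' \<le> 0"
proof -
  show 0: "g' t0 = 0"
    by (rule DERIV_local_max[of g "g' t0" t0 d]) (use g[of t0] d max in \<open>auto simp: abs_minus_commute\<close>)
  show "g'' \<le> 0"
  proof (rule ccontr)
    assume "\<not> ?thesis"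
    then obtain e where e: "e > 0" "\<And>h. 0 < h \<Longrightarrow> h < e \<Longrightarrow> 0 < g' (t0 + h)"
      using DERIV_pos_inc_right[OF g'] 0 by auto
    \<comment> \<open>if the second derivative were positive, the first would be positive to the right of
        the point, and the function would grow\<close>
    define h where "h = min d e / 2"
    have h: "0 < h" "h < d" "h < e" using d e by (auto simp: h_def)
    have "\<exists>z>t0. z < t0 + h \<and> g (t0 + h) - g t0 = (t0 + h - t0) * g' z"
      using h by (intro MVT2 g) auto
    then obtain z where z: "t0 < z" "z < t0 + h" "g (t0 + h) - g t0 = h * g' z" by auto
    have "0 < g' z" using e(2)[of "z - t0"] z h by auto
    with z(3) h have "g (t0 + h) > g t0" by (smt (verit) mult_pos_pos)
    with max[of "t0 + h"] h show False by auto
  qed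
qed

text \<open>
  Along each line through an interior maximum, the function has a maximum too; the second
  derivative along the direction \<open>(l, m)\<close> is the quadratic form below.
\<close>

lemma second_derivative_test:
  fixes w :: "real \<times> real \<Rightarrow> real"
  assumes S: "open S" "p \<in> S"
    and w: "\<And>q. q \<in> S \<Longrightarrow> GDERIV w q :> (wx q, wy q)"
    and wx: "GDERIV wx p :> (wxx, wxy)" and wy: "GDERIV wy p :> (wyx, wyy)"
    and max: "\<And>q. q \<in> S \<Longrightarrow> w q \<le> w p"
  shows "wx p = 0" "wy p = 0"
    and "wxx * l\<^sup>2 + (wxy + wyx) * l * m + wyy * m\<^sup>2 \<le> 0"
proof -
  have main: "wx p * l + wy p * m = 0 \<and> wxx * l\<^sup>2 + (wxy + wyx) * l * m + wyy * m\<^sup>2 \<le> 0" for l m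
  proof -
    let ?L = "\<lambda>t. p + t *\<^sub>R (l, m)"
    have "continuous (at 0) ?L" by (intro continuous_intros)
    moreover have "?L 0 \<in> S" using S by (simp flip: zero_prod_def)
    ultimately have "\<forall>\<^sub>F t in at 0. ?L t \<in> S"
      using S(1) unfolding continuous_within tendsto_def by auto
    then obtain d where d: "d > 0" "\<And>t. \<bar>t - 0\<bar> < d \<Longrightarrow> ?L t \<in> S"
      using S(2) unfolding eventually_at by (auto simp: dist_real_def)
       (metis add.right_neutral mult_zero_left zero_prod_def)
    have 1: "((\<lambda>t. w (?L t)) has_real_derivative (\<lambda>t. wx (?L t) * l + wy (?L t) * m) t) (at t)"
      if "\<bar>t - 0\<bar> < d" for t
      using GDERIV_along_line[OF w[OF d(2)[OF that]]] by simp
    have "((\<lambda>t. wx (?L t)) has_real_derivative (wxx * l + wxy * m)) (at 0)"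
         "((\<lambda>t. wy (?L t)) has_real_derivative (wyx * l + wyy * m)) (at 0)"
      using GDERIV_along_line[of wx p 0 "(l,m)" "(wxx, wxy)"]
        GDERIV_along_line[of wy p 0 "(l,m)" "(wyx, wyy)"] wx wy by (simp_all flip: zero_prod_def)
    from DERIV_add[OF DERIV_cmult_right[OF this(1), of l] DERIV_cmult_right[OF this(2), of m]]
    have 2: "((\<lambda>t. wx (?L t) * l + wy (?L t) * m) has_real_derivative
          ((wxx * l + wxy * m) * l + (wyx * l + wyy * m) * m)) (at 0)" by simp
    show ?thesis
      using DERIV_second_at_local_max[OF d(1) 1 2] max d(2) S
      by (simp add: power2_eq_square algebra_simps flip: zero_prod_def)
  qed
  show "wx p = 0" using main[of 1 0] by simp
  show "wy p = 0" using main[of 0 1] by simp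
  show "wxx * l\<^sup>2 + (wxy + wyx) * l * m + wyy * m\<^sup>2 \<le> 0" using main by blast
qed

section \<open>A boundary point lemma for degenerate elliptic operators\<close>

lemma GDERIV_add_cmult:
  assumes "GDERIV h p :> (h1, h2)" "GDERIV k p :> (k1, k2)"
  shows "GDERIV (\<lambda>q. h q + e * k q) p :> (h1 + e * k1, h2 + e * k2)"
  using assms unfolding gderiv_def
  by (auto intro!: derivative_eq_intros simp: inner_prod_def algebra_simps)

text \<open>
  The region between a parabola and a line parallel to its tangent at \<open>(x0, y0)\<close>. That point is
  extreme, so the region stays convex, hence connected, without it.
\<close>

lemma convex_parabola_region:
  fixes x0 y0 m K \<delta> \<eta> :: real
  defines "N \<equiv> \<lambda>q. \<eta> * ((snd q - y0) - m * (fst q - x0))"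
  assumes "K > 0" "\<eta> \<noteq> 0"
  shows "convex ({q. K * (fst q - x0)\<^sup>2 \<le> N q \<and> N q \<le> \<delta>} - {(x0, y0)})" (is "convex ?R")
proof (rule convexI)
  fix p q :: "real \<times> real" and a b :: real
  assume p: "p \<in> ?R" and q: "q \<in> ?R" and ab: "0 \<le> a" "0 \<le> b" "a + b = 1"
  let ?z = "a *\<^sub>R p + b *\<^sub>R q"
  have pos: "N r > 0" if "r \<in> ?R" for r
  proof (rule ccontr)
    assume "\<not> ?thesis"
    moreover have "0 \<le> K * (fst r - x0)\<^sup>2" "K * (fst r - x0)\<^sup>2 \<le> N r"
      using that assms(2) by simp_all
    ultimately have "N r = 0" "K * (fst r - x0)\<^sup>2 = 0" by linarith+
    then show False using that assms(2,3) by (cases r) (simp add: N_def)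
  qed
  have b: "b = 1 - a" using ab by simp
  have Nz: "N ?z = a * N p + b * N q" unfolding b N_def by (simp add: algebra_simps)
  \<comment> \<open>convexity of the square, with the exact defect\<close>
  have "(fst ?z - x0)\<^sup>2 = a * (fst p - x0)\<^sup>2 + b * (fst q - x0)\<^sup>2 - a * b * (fst p - fst q)\<^sup>2"
    unfolding b by (simp add: power2_eq_square algebra_simps)
  also have "\<dots> \<le> a * (fst p - x0)\<^sup>2 + b * (fst q - x0)\<^sup>2" using ab by simp
  finally have "K * (fst ?z - x0)\<^sup>2 \<le> K * (a * (fst p - x0)\<^sup>2 + b * (fst q - x0)\<^sup>2)"
    using assms(2) by simp
  also have "\<dots> = a * (K * (fst p - x0)\<^sup>2) + b * (K * (fst q - x0)\<^sup>2)" by (simp add: algebra_simps)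
  also have "\<dots> \<le> a * N p + b * N q" using p q ab by (intro add_mono mult_left_mono) auto
  finally have 1: "K * (fst ?z - x0)\<^sup>2 \<le> N ?z" by (simp add: Nz)
  have 2: "N ?z \<le> \<delta>" unfolding Nz using p q ab by (intro convex_bound_le) auto
  have "0 < N ?z"
    unfolding Nz using pos[OF p] pos[OF q] ab
    by (cases "a = 0") (auto intro: add_pos_nonneg)
  moreover have "N (x0, y0) = 0" by (simp add: N_def)
  ultimately have "?z \<noteq> (x0, y0)" by (metis less_irrefl)
  with 1 2 show "?z \<in> ?R" by simp
qed

text \<open>
  Hopf's boundary point lemma at a point \<open>(x0, y0)\<close> of a parabola that opens in the direction
  \<open>\<eta> (0, 1)\<close> and has slope \<open>m\<close> there, for an operator with unit coefficient at the second
  \<open>y\<close>-derivative. The operator may degenerate: ellipticity enters only as \<open>b\<^sup>2 \<le> 4 a\<close>. With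
  \<open>z = N - K (x - x0)\<^sup>2\<close>, which vanishes on the parabola and is positive inside, the function
  \<open>z + 3 C z\<^sup>2\<close> is a strict subsolution. The hypothesis \<open>main\<close> keeps its principal part positive, and
  \<open>lower\<close> bounds from below what the operator does to \<open>z\<close> itself; \<open>zx\<close> and \<open>\<eta>\<close> are the partial derivatives
  of \<open>z\<close>. A small multiple of this barrier can be added to \<open>w\<close> without exceeding \<open>w (x0, y0)\<close>,
  and the barrier has slope \<open>1\<close> at \<open>(x0, y0)\<close> in the direction \<open>\<eta> (0, 1)\<close>.
\<close>

lemma hopf_lemma_parabola:
  fixes w wx wy wxx wxy wyy a b b1 b2 :: "real \<times> real \<Rightarrow> real" and x0 y0 m K \<delta> C \<eta> :: real
  defines "N \<equiv> \<lambda>q. \<eta> * ((snd q - y0) - m * (fst q - x0))"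
  defines "R \<equiv> {q. K * (fst q - x0)\<^sup>2 \<le> N q \<and> N q \<le> \<delta>}"
  defines "zx \<equiv> \<lambda>q. - \<eta> * m - 2 * K * (fst q - x0)"
  assumes \<eta>: "\<eta> = 1 \<or> \<eta> = -1" and pos: "K > 0" "\<delta> > 0" "C > 0" and small: "6 * C * \<delta> \<le> 1"
    and \<Omega>: "open \<Omega>" "R \<subseteq> \<Omega>"
    and w: "\<And>q. q \<in> \<Omega> \<Longrightarrow> GDERIV w q :> (wx q, wy q)"
    and wx: "\<And>q. q \<in> \<Omega> \<Longrightarrow> GDERIV wx q :> (wxx q, wxy q)"
    and wy: "\<And>q. q \<in> \<Omega> \<Longrightarrow> GDERIV wy q :> (wxy q, wyy q)"
    and neg: "\<And>q. q \<in> R \<Longrightarrow> q \<noteq> (x0, y0) \<Longrightarrow> w q < w (x0, y0)"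
    and eq: "\<And>q. q \<in> R \<Longrightarrow> q \<noteq> (x0, y0) \<Longrightarrow>
        0 \<le> wyy q + a q * wxx q + b q * wxy q + b1 q * wx q + b2 q * wy q"
    and ell: "\<And>q. q \<in> R \<Longrightarrow> q \<noteq> (x0, y0) \<Longrightarrow> (b q)\<^sup>2 \<le> 4 * a q"
    and main: "\<And>q. q \<in> R \<Longrightarrow> q \<noteq> (x0, y0) \<Longrightarrow> 1 / 2 \<le> 1 + a q * (zx q)\<^sup>2 + b q * zx q * \<eta>"
    and lower: "\<And>q. q \<in> R \<Longrightarrow> q \<noteq> (x0, y0) \<Longrightarrow> - C \<le> - 2 * K * a q + b1 q * zx q + b2 q * \<eta>"
  shows "\<eta> * wy (x0, y0) < 0"
proof -
  let ?p0 = "(x0, y0)"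
  have eta2: "\<eta> * \<eta> = 1" "\<eta>\<^sup>2 = 1" using \<eta> by auto
  define z where "z = (\<lambda>q. N q - K * (fst q - x0)\<^sup>2)"
  define B where "B = (\<lambda>q. z q + 3 * C * (z q)\<^sup>2)"
  have GN: "GDERIV N q :> (- \<eta> * m, \<eta>)" for q
    unfolding gderiv_def N_def
    by (auto intro!: derivative_eq_intros simp: inner_prod_def algebra_simps)
  have Gz: "GDERIV z q :> (zx q, \<eta>)" for q
    using GN[of q] unfolding gderiv_def z_def zx_def
    by (auto intro!: derivative_eq_intros simp: inner_prod_def algebra_simps)
  have GB: "GDERIV B q :> ((1 + 6 * C * z q) * zx q, (1 + 6 * C * z q) * \<eta>)" for q
    using Gz[of q] unfolding gderiv_def B_def
    by (auto intro!: derivative_eq_intros simp: inner_prod_def algebra_simps)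
  have Gzx: "GDERIV zx q :> (- 2 * K, 0)" for q
    unfolding gderiv_def zx_def
    by (auto intro!: derivative_eq_intros simp: inner_prod_def algebra_simps)
  have GBx: "GDERIV (\<lambda>q. (1 + 6 * C * z q) * zx q) q :>
      (6 * C * (zx q)\<^sup>2 - 2 * K * (1 + 6 * C * z q), 6 * C * zx q * \<eta>)" for q
    using Gz[of q] Gzx[of q] unfolding gderiv_def
    by (auto intro!: derivative_eq_intros simp: inner_prod_def algebra_simps power2_eq_square)
  have GBy: "GDERIV (\<lambda>q. (1 + 6 * C * z q) * \<eta>) q :> (6 * C * zx q * \<eta>, 6 * C)" for q
    using Gz[of q] eta2 unfolding gderiv_def
    by (auto intro!: derivative_eq_intros simp: inner_prod_def algebra_simps)
  have contN: "continuous_on UNIV N" unfolding N_def by (intro continuous_intros)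
  have contz: "continuous_on UNIV z" unfolding z_def by (intro continuous_intros contN)
  have contB: "continuous_on UNIV B" unfolding B_def by (intro continuous_intros contz)
  have contw: "continuous_on \<Omega> w"
    using w unfolding gderiv_def
    by (meson continuous_at_imp_continuous_on has_derivative_continuous)
  have p0R: "?p0 \<in> R" using pos by (simp add: R_def N_def)
  have "compact R"
  proof (rule compact_eq_bounded_closed[THEN iffD2], intro conjI)
    show "closed R" unfolding R_def N_def
      by (intro closed_Collect_conj closed_Collect_le continuous_intros)
    define d where "d = sqrt (\<delta> / K)"
    have "R \<subseteq> cbox (x0 - d, y0 - \<bar>m\<bar> * d - \<delta>) (x0 + d, y0 + \<bar>m\<bar> * d + \<delta>)"
    proof
      fix q assume q: "q \<in> R"
      define X where "X = fst q - x0"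
      define Y where "Y = snd q - y0"
      have h: "K * X\<^sup>2 \<le> \<eta> * (Y - m * X)" "\<eta> * (Y - m * X) \<le> \<delta>"
        using q by (auto simp: R_def N_def X_def Y_def)
      have "0 \<le> K * X\<^sup>2" using pos by simp
      with h have Yb: "\<bar>Y - m * X\<bar> \<le> \<delta>" using \<eta> by auto
      have "X\<^sup>2 \<le> \<delta> / K" using h pos by (simp add: field_simps)
      then have Xb: "\<bar>X\<bar> \<le> d" unfolding d_def by (metis real_sqrt_abs real_sqrt_le_iff)
      have "\<bar>m * X\<bar> \<le> \<bar>m\<bar> * d" using Xb by (simp add: abs_mult mult_left_mono)
      with Yb have "\<bar>Y\<bar> \<le> \<bar>m\<bar> * d + \<delta>" by linarith
      with Xb show "q \<in> cbox (x0 - d, y0 - \<bar>m\<bar> * d - \<delta>) (x0 + d, y0 + \<bar>m\<bar> * d + \<delta>)"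
        by (cases q) (auto simp: X_def Y_def cbox_Pair_eq abs_le_iff)
    qed
    then show "bounded R" by (rule bounded_subset[OF bounded_cbox])
  qed
  \<comment> \<open>the straight part of the boundary is compact and avoids \<open>(x0, y0)\<close>, so \<open>w\<close> stays below its
      value at that point by a fixed amount \<open>\<mu>\<close> there\<close>
  define T where "T = R \<inter> {q. N q = \<delta>}"
  have "compact T" unfolding T_def
    by (intro compact_Int_closed \<open>compact R\<close> closed_Collect_eq contN continuous_on_const)
  moreover have "(x0, y0 + \<eta> * \<delta>) \<in> T"
    using pos eta2 by (simp add: T_def R_def N_def flip: mult.assoc)
  moreover have "continuous_on T w" by (rule continuous_on_subset[OF contw]) (use \<Omega>(2) in \<open>auto simp: T_def\<close>)
  ultimately obtain qT where qT: "qT \<in> T" "\<And>q. q \<in> T \<Longrightarrow> w q \<le> w qT"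
    using continuous_attains_sup[of T w] by blast
  define \<mu> where "\<mu> = w ?p0 - w qT"
  have "qT \<noteq> ?p0" using qT(1) pos by (auto simp: T_def N_def)
  then have \<mu>: "\<mu> > 0" using neg[of qT] qT(1) by (auto simp: \<mu>_def T_def)
  define e where "e = \<mu> / (2 * \<delta>)"
  have e: "e > 0" using \<mu> pos by (simp add: e_def)
  have zb: "0 \<le> z q" "z q \<le> N q" "N q \<le> \<delta>" if "q \<in> R" for q
    using that pos by (auto simp: z_def R_def)
  have Bb: "B q \<le> 2 * \<delta>" if "q \<in> R" for q
  proof -
    have "z q \<le> \<delta>" "0 \<le> z q" using zb[OF that] by auto
    then have "(z q)\<^sup>2 \<le> \<delta> * \<delta>" by (simp add: power2_eq_square mult_mono)
    then have "C * (z q)\<^sup>2 \<le> C * (\<delta> * \<delta>)" using pos by simp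
    also have "\<dots> = (6 * C * \<delta>) * \<delta> / 6" by simp
    also have "\<dots> \<le> 1 * \<delta> / 6" using mult_right_mono[OF small, of \<delta>] pos by simp
    finally show ?thesis using \<open>z q \<le> \<delta>\<close> pos unfolding B_def by linarith
  qed
  define W where "W = (\<lambda>q. w q + e * B q)"
  have contW: "continuous_on R W" unfolding W_def
    by (intro continuous_intros continuous_on_subset[OF contw \<Omega>(2)] continuous_on_subset[OF contB]) auto
  obtain q1 where q1: "q1 \<in> R" "\<And>q. q \<in> R \<Longrightarrow> W q \<le> W q1"
    using continuous_attains_sup[OF \<open>compact R\<close> _ contW] p0R by blast
  have "W q1 \<le> w ?p0"
  proof (rule ccontr)
    assume "\<not> ?thesis"
    then have big: "W q1 > w ?p0" by simp
    have B0: "B q = 0" if "z q = 0" for q using that by (simp add: B_def)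
    have "z ?p0 = 0" by (simp add: z_def N_def)
    then have ne: "q1 \<noteq> ?p0" using big B0 by (auto simp: W_def)
    have "N q1 \<noteq> \<delta>"
    proof
      assume "N q1 = \<delta>"
      then have "w q1 \<le> w qT" using q1 qT by (auto simp: T_def)
      moreover have "e * B q1 \<le> e * (2 * \<delta>)" using Bb[OF q1(1)] e by simp
      moreover have "e * (2 * \<delta>) = \<mu>" using pos by (simp add: e_def)
      ultimately show False using big by (simp add: W_def \<mu>_def)
    qed
    moreover have "z q1 \<noteq> 0"
    proof
      assume "z q1 = 0"
      then show False using big B0 neg[OF q1(1) ne] by (simp add: W_def)
    qed
    ultimately have int: "q1 \<in> {q. 0 < z q} \<inter> {q. N q < \<delta>}" (is "_ \<in> ?I")
      using zb[OF q1(1)] by auto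
    have openI: "open ?I"
      by (intro open_Int open_Collect_less contz contN continuous_on_const)
    have IR: "?I \<subseteq> R" by (auto simp: R_def z_def)
    have GW: "GDERIV W q :> (wx q + e * ((1 + 6 * C * z q) * zx q), wy q + e * ((1 + 6 * C * z q) * \<eta>))"
      if "q \<in> ?I" for q
      unfolding W_def by (rule GDERIV_add_cmult[OF w GB]) (use that IR \<Omega> in blast)
    have q1\<Omega>: "q1 \<in> \<Omega>" using q1 \<Omega> by auto
    let ?xx = "wxx q1 + e * (6 * C * (zx q1)\<^sup>2 - 2 * K * (1 + 6 * C * z q1))"
    let ?xy = "wxy q1 + e * (6 * C * zx q1 * \<eta>)"
    let ?yy = "wyy q1 + e * (6 * C)"
    have GWx: "GDERIV (\<lambda>q. wx q + e * ((1 + 6 * C * z q) * zx q)) q1 :> (?xx, ?xy)"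
      by (rule GDERIV_add_cmult[OF wx[OF q1\<Omega>] GBx])
    have GWy: "GDERIV (\<lambda>q. wy q + e * ((1 + 6 * C * z q) * \<eta>)) q1 :> (?xy, ?yy)"
      by (rule GDERIV_add_cmult[OF wy[OF q1\<Omega>] GBy])
    have maxI: "\<And>q. q \<in> ?I \<Longrightarrow> W q \<le> W q1" using q1 IR by blast
    \<comment> \<open>the operator splits as the second derivative along \<open>(b / 2, 1)\<close> plus
        \<open>a - (b / 2)\<^sup>2 \<ge> 0\<close> times the second derivative along \<open>(1, 0)\<close>\<close>
    note test = second_derivative_test[OF openI int GW GWx GWy maxI]
    have "?xx * (b q1 / 2)\<^sup>2 + (?xy + ?xy) * (b q1 / 2) * 1 + ?yy * 1\<^sup>2 \<le> 0" by (rule test(3))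
    moreover have "?xx \<le> 0" using test(3)[of 1 0] by simp
    then have "?xx * (a q1 - (b q1 / 2)\<^sup>2) \<le> 0"
      using ell[OF q1(1) ne] by (intro mult_nonpos_nonneg) (auto simp: power2_eq_square)
    ultimately have "?yy + a q1 * ?xx + b q1 * ?xy \<le> 0" by (simp add: algebra_simps)
    moreover have "b1 q1 * (wx q1 + e * ((1 + 6 * C * z q1) * zx q1)) = 0"
      "b2 q1 * (wy q1 + e * ((1 + 6 * C * z q1) * \<eta>)) = 0"
      using test(1,2) by auto
    ultimately have "wyy q1 + a q1 * wxx q1 + b q1 * wxy q1 + b1 q1 * wx q1 + b2 q1 * wy q1
       + e * (6 * C * (1 + a q1 * (zx q1)\<^sup>2 + b q1 * zx q1 * \<eta>)
         + (1 + 6 * C * z q1) * (- 2 * K * a q1 + b1 q1 * zx q1 + b2 q1 * \<eta>)) \<le> 0"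
      by (simp add: algebra_simps)
    then have "e * (6 * C * (1 + a q1 * (zx q1)\<^sup>2 + b q1 * zx q1 * \<eta>)
         + (1 + 6 * C * z q1) * (- 2 * K * a q1 + b1 q1 * zx q1 + b2 q1 * \<eta>)) \<le> 0"
      using eq[OF q1(1) ne] by linarith
    \<comment> \<open>the square in the barrier contributes at least \<open>3 C\<close>, the rest at least \<open>- 2 C\<close>\<close>
    moreover have "6 * C * (1 / 2) \<le> 6 * C * (1 + a q1 * (zx q1)\<^sup>2 + b q1 * zx q1 * \<eta>)"
      using main[OF q1(1) ne] pos by (intro mult_left_mono) auto
    moreover have "2 * (- C) \<le> (1 + 6 * C * z q1) * (- 2 * K * a q1 + b1 q1 * zx q1 + b2 q1 * \<eta>)"
    proof -
      have "6 * C * z q1 \<le> 6 * C * \<delta>" using zb[OF q1(1)] pos by (intro mult_left_mono) auto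
      then have "1 + 6 * C * z q1 \<le> 2" using small by simp
      moreover have "0 \<le> 1 + 6 * C * z q1" using zb[OF q1(1)] pos by simp
      ultimately have "2 * (- C) \<le> (1 + 6 * C * z q1) * (- C)" using pos by simp
      also have "\<dots> \<le> (1 + 6 * C * z q1) * (- 2 * K * a q1 + b1 q1 * zx q1 + b2 q1 * \<eta>)"
        using lower[OF q1(1) ne] \<open>0 \<le> 1 + 6 * C * z q1\<close> by (rule mult_left_mono)
      finally show ?thesis .
    qed
    ultimately have "e * (6 * C * (1 + a q1 * (zx q1)\<^sup>2 + b q1 * zx q1 * \<eta>)
         + (1 + 6 * C * z q1) * (- 2 * K * a q1 + b1 q1 * zx q1 + b2 q1 * \<eta>)) \<le> 0" 
      and "C \<le> (6 * C * (1 + a q1 * (zx q1)\<^sup>2 + b q1 * zx q1 * \<eta>)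
         + (1 + 6 * C * z q1) * (- 2 * K * a q1 + b1 q1 * zx q1 + b2 q1 * \<eta>))" by linarith+
    then show False using e pos by (simp add: mult_le_0_iff)
  qed
  then have Wle: "w q + e * B q \<le> w ?p0" if "q \<in> R" for q using q1(2)[OF that] by (simp add: W_def)
  \<comment> \<open>on the vertical segment from \<open>(x0, y0)\<close> into the region, \<open>z\<close> is the distance \<open>t\<close>\<close>
  define g where "g = (\<lambda>t. w (?p0 + t *\<^sub>R (0, \<eta>)) + e * t)"
  have "GDERIV w (?p0 + 0 *\<^sub>R (0, \<eta>)) :> (wx ?p0, wy ?p0)" using w[of ?p0] p0R \<Omega> by auto
  from GDERIV_along_line[OF this]
  have "(g has_real_derivative (wx ?p0, wy ?p0) \<bullet> (0, \<eta>) + e) (at 0)"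
    unfolding g_def by (intro DERIV_add DERIV_cmult_Id)
  then have Dg: "(g has_real_derivative \<eta> * wy ?p0 + e) (at 0)" by (simp add: mult.commute)
  show ?thesis
  proof (rule ccontr)
    assume "\<not> ?thesis"
    then have "\<eta> * wy ?p0 + e > 0" using e by simp
    then obtain d where d: "d > 0" "\<And>h. h > 0 \<Longrightarrow> h < d \<Longrightarrow> g 0 < g (0 + h)"
      using DERIV_pos_inc_right[OF Dg] by blast
    define h where "h = min d \<delta> / 2"
    have h: "0 < h" "h < d" "h \<le> \<delta>" using d pos by (auto simp: h_def)
    define q where "q = ?p0 + h *\<^sub>R (0, \<eta>)"
    have Nq: "N q = h" "fst q = x0" using eta2 by (auto simp: q_def N_def)
    have "q \<in> R" using h Nq by (simp add: R_def)
    from Wle[OF this] have "w q + e * (h + 3 * C * h\<^sup>2) \<le> w ?p0"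
      using Nq by (simp add: B_def z_def)
    moreover have "e * (3 * C * h\<^sup>2) \<ge> 0" using e pos by simp
    ultimately have "g h \<le> g 0" by (simp add: g_def q_def algebra_simps)
    then show False using d(2)[of h] h by simp
  qed
qed

section \<open>The two sides of an arc in the plane\<close>

definition left_normal :: "real \<times> real \<Rightarrow> real \<times> real" where
  "left_normal \<tau> = (- snd \<tau>, fst \<tau>)"

lemma left_normal_inner [simp]: "left_normal \<tau> \<bullet> \<tau> = 0" "\<tau> \<bullet> left_normal \<tau> = 0"
  by (auto simp: left_normal_def inner_prod_def)

lemma norm_left_normal [simp]: "norm (left_normal \<tau>) = norm \<tau>"
  by (simp add: left_normal_def norm_prod_def add.commute)

text \<open>
  A unit vector of the plane and its left normal form an orthonormal basis.
\<close>

lemma decompose_left_normal: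
  assumes "norm \<tau> = 1"
  shows "x = (x \<bullet> \<tau>) *\<^sub>R \<tau> + (x \<bullet> left_normal \<tau>) *\<^sub>R left_normal \<tau>"
proof -
  obtain a b where t: "\<tau> = (a, b)" by (cases \<tau>)
  obtain c d where x: "x = (c, d)" by (cases x)
  have "a\<^sup>2 + b\<^sup>2 = 1" using assms by (simp add: t norm_prod_def real_sqrt_eq_1_iff)
  then have "c * (a\<^sup>2 + b\<^sup>2) = c" "d * (a\<^sup>2 + b\<^sup>2) = d" by simp_all
  then show ?thesis
    unfolding t x left_normal_def by (simp add: power2_eq_square algebra_simps)
qed

lemma continuous_nonzero_sign:
  fixes g :: "'a::topological_space \<Rightarrow> real"
  assumes "connected A" "continuous_on A g" "\<And>x. x \<in> A \<Longrightarrow> g x \<noteq> 0"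
  shows "(\<forall>x\<in>A. 0 < g x) \<or> (\<forall>x\<in>A. g x < 0)"
proof (rule ccontr)
  assume "\<not> ?thesis"
  then obtain x y where xy: "x \<in> A" "y \<in> A" "g x \<le> 0" "0 \<le> g y" by (meson not_less)
  have "connected (g ` A)" using assms by (intro connected_continuous_image)
  then have "0 \<in> g ` A" using connectedD_interval[of "g ` A" "g x" "g y" 0] xy by auto
  then show False using assms(3) by auto
qed

locale regular_arc =
  fixes \<sigma> \<sigma>' :: "real \<Rightarrow> real \<times> real" and L :: real
  assumes L_pos: "0 < L"
    and inj: "inj_on \<sigma> {0..L}"
    and deriv: "\<And>s. s \<in> {0..L} \<Longrightarrow> (\<sigma> has_vector_derivative \<sigma>' s) (at s within {0..L})"
    and unit: "\<And>s. s \<in> {0..L} \<Longrightarrow> norm (\<sigma>' s) = 1"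
    and cont_tangent: "continuous_on {0..L} \<sigma>'"
begin

abbreviation \<nu> :: "real \<Rightarrow> real \<times> real" where "\<nu> s \<equiv> left_normal (\<sigma>' s)"

lemma cont: "continuous_on {0..L} \<sigma>"
  by (meson deriv continuous_on_eq_continuous_within has_vector_derivative_continuous)

lemma cont_normal: "continuous_on {0..L} \<nu>"
  unfolding left_normal_def by (intro continuous_intros cont_tangent)

lemma deriv_interior: "s \<in> {0<..<L} \<Longrightarrow> (\<sigma> has_vector_derivative \<sigma>' s) (at s)"
  using deriv[of s] by (simp add: at_within_Icc_at)

text \<open>
  An arc does not come back close to itself: its inverse is continuous, by compactness.
\<close>

lemma parameter_close:
  assumes "s \<in> {0..L}" "e > 0"
  shows "\<exists>\<rho>>0. \<forall>r\<in>{0..L}. dist (\<sigma> r) (\<sigma> s) < \<rho> \<longrightarrow> \<bar>r - s\<bar> < e"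
proof -
  let ?g = "the_inv_into {0..L} \<sigma>"
  have "continuous_on (\<sigma> ` {0..L}) ?g"
    by (rule continuous_on_inv_into[OF cont _ inj]) simp
  then have "\<exists>\<rho>>0. \<forall>x\<in>\<sigma> ` {0..L}. dist x (\<sigma> s) < \<rho> \<longrightarrow> dist (?g x) (?g (\<sigma> s)) < e"
    using assms unfolding continuous_on_iff by blast
  then show ?thesis
    using assms(1) by (simp add: the_inv_into_f_f[OF inj] dist_real_def)
qed

lemma close_parameter:
  assumes "s \<in> {0<..<L}" "e > 0"
  shows "\<exists>d>0. \<forall>r. \<bar>r - s\<bar> < d \<longrightarrow> r \<in> {0<..<L} \<and> dist (\<sigma> r) (\<sigma> s) < e \<and> dist (\<sigma>' r) (\<sigma>' s) < e"
proof -
  have s: "s \<in> {0..L}" using assms by auto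
  obtain d1 where d1: "d1 > 0" "\<And>r. r \<in> {0..L} \<Longrightarrow> dist r s < d1 \<Longrightarrow> dist (\<sigma> r) (\<sigma> s) < e"
    using cont[unfolded continuous_on_iff, rule_format, OF s assms(2)] by blast
  obtain d2 where d2: "d2 > 0" "\<And>r. r \<in> {0..L} \<Longrightarrow> dist r s < d2 \<Longrightarrow> dist (\<sigma>' r) (\<sigma>' s) < e"
    using cont_tangent[unfolded continuous_on_iff, rule_format, OF s assms(2)] by blast
  show ?thesis
    by (rule exI[of _ "min (min d1 d2) (min s (L - s))"])
       (use d1 d2 assms in \<open>auto simp: dist_real_def abs_less_iff\<close>)
qed

text \<open>
  For nearby parameters the chord \<open>\<sigma> r' - \<sigma> r\<close> is almost \<open>(r' - r) \<sigma>' r\<close>, so it is not orthogonal to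
  \<open>\<sigma>' r\<close>; distant parameters are excluded by \<open>parameter_close\<close>. Short normal segments therefore
  meet the arc only at their foot point.
\<close>

lemma normal_segment_off_arc:
  assumes s: "s \<in> {0<..<L}"
  obtains e where "e > 0" "\<And>r. \<bar>r - s\<bar> < e \<Longrightarrow> r \<in> {0<..<L}"
    "\<And>r d. \<bar>r - s\<bar> < e \<Longrightarrow> d \<noteq> 0 \<Longrightarrow> \<bar>d\<bar> < e \<Longrightarrow> \<sigma> r + d *\<^sub>R \<nu> r \<notin> \<sigma> ` {0..L}"
proof -
  have s': "s \<in> {0..L}" using s by simp
  have quarter: "(0::real) < 1/4" by simp
  from close_parameter[OF s quarter] obtain e0 where "e0 > 0"
    "\<forall>r. \<bar>r - s\<bar> < e0 \<longrightarrow> r \<in> {0<..<L} \<and> dist (\<sigma> r) (\<sigma> s) < 1/4 \<and> dist (\<sigma>' r) (\<sigma>' s) < 1/4"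
    by blast
  note e0 = this(1) this(2)[rule_format]
  have chord: "norm (\<sigma> r' - \<sigma> r - (r' - r) *\<^sub>R \<sigma>' r) \<le> \<bar>r' - r\<bar> * (1/2)"
    if r: "\<bar>r - s\<bar> < e0" "\<bar>r' - s\<bar> < e0" for r r'
  proof -
    let ?S = "{s - e0<..<s + e0}"
    have "norm (\<sigma> r' - \<sigma> r - (r' - r) *\<^sub>R \<sigma>' r) \<le> norm (r' - r) * (1/2)"
    proof (rule vector_differentiable_bound_linearization[where S = ?S])
      show "(\<sigma> has_vector_derivative \<sigma>' x) (at x within ?S)" if "x \<in> ?S" for x
      proof -
        have "\<bar>x - s\<bar> < e0" using that by (auto simp: abs_less_iff)
        then have "x \<in> {0<..<L}" using e0(2) by blast
        then show ?thesis by (rule has_vector_derivative_at_within[OF deriv_interior])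
      qed
      show "closed_segment r r' \<subseteq> ?S"
        using r by (intro closed_segment_subset) (auto simp: abs_less_iff)
      show "norm (\<sigma>' x - \<sigma>' r) \<le> 1/2" if "x \<in> ?S" for x
      proof -
        have "\<bar>x - s\<bar> < e0" using that by (auto simp: abs_less_iff)
        then have "dist (\<sigma>' x) (\<sigma>' s) < 1/4" "dist (\<sigma>' r) (\<sigma>' s) < 1/4"
          using e0(2)[of x] e0(2)[of r] r by blast+
        then have "dist (\<sigma>' x) (\<sigma>' r) < 1/2"
          using dist_triangle2[of "\<sigma>' x" "\<sigma>' r" "\<sigma>' s"] by linarith
        then show ?thesis by (simp add: dist_norm)
      qed
    qed (use r in \<open>auto simp: abs_less_iff\<close>)
    then show ?thesis by simp
  qed
  obtain \<rho> where \<rho>: "\<rho> > 0" "\<And>r. r \<in> {0..L} \<Longrightarrow> dist (\<sigma> r) (\<sigma> s) < \<rho> \<Longrightarrow> \<bar>r - s\<bar> < e0"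
    using parameter_close[OF s' e0(1)] by blast
  obtain e1 where e1: "e1 > 0" "\<And>r. \<bar>r - s\<bar> < e1 \<Longrightarrow> dist (\<sigma> r) (\<sigma> s) < \<rho>/2"
    using close_parameter[OF s half_gt_zero[OF \<rho>(1)]] by blast
  define e where "e = min e0 (min e1 (\<rho>/2))"
  show ?thesis
  proof (rule that[of e])
    show "e > 0" using e0 e1 \<rho> by (simp add: e_def)
    show "r \<in> {0<..<L}" if "\<bar>r - s\<bar> < e" for r using e0(2)[of r] that by (simp add: e_def)
    show "\<sigma> r + d *\<^sub>R \<nu> r \<notin> \<sigma> ` {0..L}" if h: "\<bar>r - s\<bar> < e" "d \<noteq> 0" "\<bar>d\<bar> < e" for r d
    proof
      assume "\<sigma> r + d *\<^sub>R \<nu> r \<in> \<sigma> ` {0..L}"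
      then obtain r' where r': "r' \<in> {0..L}" "\<sigma> r + d *\<^sub>R \<nu> r = \<sigma> r'" by auto
      have r0: "\<bar>r - s\<bar> < e0" "\<bar>r - s\<bar> < e1" "\<bar>d\<bar> < \<rho>/2" using h by (auto simp: e_def)
      have u: "norm (\<sigma>' r) = 1" using e0(2)[OF r0(1)] unit by auto
      have "dist (\<sigma> r') (\<sigma> r) = \<bar>d\<bar>" using u by (simp add: dist_norm flip: r'(2))
      then have "dist (\<sigma> r') (\<sigma> s) < \<rho>"
        using dist_triangle[of "\<sigma> r'" "\<sigma> s" "\<sigma> r"] e1(2)[OF r0(2)] r0(3) by linarith
      then have "\<bar>r' - s\<bar> < e0" using \<rho>(2) r' by blast
      \<comment> \<open>project the chord onto the tangent, to which \<open>\<nu> r\<close> is orthogonal\<close>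
      have "norm (d *\<^sub>R \<nu> r - (r' - r) *\<^sub>R \<sigma>' r) \<le> \<bar>r' - r\<bar> * (1/2)"
        using chord[OF r0(1) \<open>\<bar>r' - s\<bar> < e0\<close>] by (simp flip: r'(2))
      moreover have "\<bar>(d *\<^sub>R \<nu> r - (r' - r) *\<^sub>R \<sigma>' r) \<bullet> \<sigma>' r\<bar> \<le> norm (d *\<^sub>R \<nu> r - (r' - r) *\<^sub>R \<sigma>' r)"
        using Cauchy_Schwarz_ineq2[of "d *\<^sub>R \<nu> r - (r' - r) *\<^sub>R \<sigma>' r" "\<sigma>' r"] u by simp
      moreover have "(d *\<^sub>R \<nu> r - (r' - r) *\<^sub>R \<sigma>' r) \<bullet> \<sigma>' r = - (r' - r)"
        using u by (simp add: inner_diff_left dot_square_norm)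
      ultimately have "r' = r" by (simp add: abs_if split: if_splits)
      then have "d *\<^sub>R \<nu> r = 0" using r'(2) by simp
      then have "norm (d *\<^sub>R \<nu> r) = 0" by (simp only: norm_zero)
      then show False using u \<open>d \<noteq> 0\<close> by simp
    qed
  qed
qed

text \<open>
  Every point near the arc lies on a normal segment: the one at its nearest point on the arc. This
  replaces an inverse function theorem for the map \<open>(r, d) \<mapsto> \<sigma> r + d \<nu> r\<close>.
\<close>

lemma foot_point:
  assumes s: "s \<in> {0<..<L}" and e: "e > 0"
  obtains \<rho> where "\<rho> > 0"
    "\<And>p. dist p (\<sigma> s) < \<rho> \<Longrightarrow> \<exists>r d. \<bar>r - s\<bar> < e \<and> \<bar>d\<bar> < e \<and> p = \<sigma> r + d *\<^sub>R \<nu> r"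
proof -
  have s': "s \<in> {0..L}" using s by simp
  define e' where "e' = min e (min s (L - s))"
  have e': "e' > 0" using s e by (simp add: e'_def)
  obtain \<rho> where \<rho>: "\<rho> > 0" "\<And>r. r \<in> {0..L} \<Longrightarrow> dist (\<sigma> r) (\<sigma> s) < \<rho> \<Longrightarrow> \<bar>r - s\<bar> < e'"
    using parameter_close[OF s' e'] by blast
  show ?thesis
  proof (rule that[of "min (\<rho>/2) e"])
    fix p assume p: "dist p (\<sigma> s) < min (\<rho>/2) e"
    have "continuous_on {0..L} (\<lambda>r. dist p (\<sigma> r))" by (intro continuous_intros cont)
    then obtain r where r: "r \<in> {0..L}" "\<And>r'. r' \<in> {0..L} \<Longrightarrow> dist p (\<sigma> r) \<le> dist p (\<sigma> r')"
      using continuous_attains_inf[of "{0..L}" "\<lambda>r. dist p (\<sigma> r)"] L_pos by auto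
    have le: "dist p (\<sigma> r) \<le> dist p (\<sigma> s)" using r s by auto
    then have "dist (\<sigma> r) (\<sigma> s) < \<rho>"
      using p dist_triangle3[of "\<sigma> r" "\<sigma> s" p] by linarith
    then have rs: "\<bar>r - s\<bar> < e'" using \<rho> r by blast
    then have ri: "r \<in> {0<..<L}" by (auto simp: e'_def)
    have "((\<lambda>r. p - \<sigma> r) has_vector_derivative - \<sigma>' r) (at r)"
      using deriv_interior[OF ri] by (auto intro!: derivative_eq_intros)
    then have "((\<lambda>r. (p - \<sigma> r) \<bullet> (p - \<sigma> r)) has_derivative
        (\<lambda>h. (p - \<sigma> r) \<bullet> (h *\<^sub>R (- \<sigma>' r)) + (h *\<^sub>R (- \<sigma>' r)) \<bullet> (p - \<sigma> r))) (at r)"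
      unfolding has_vector_derivative_def by (intro has_derivative_inner)
    moreover have "(\<lambda>h. (p - \<sigma> r) \<bullet> (h *\<^sub>R (- \<sigma>' r)) + (h *\<^sub>R (- \<sigma>' r)) \<bullet> (p - \<sigma> r))
        = (*) (- 2 * ((p - \<sigma> r) \<bullet> \<sigma>' r))"
      by (auto simp: inner_commute)
    ultimately have D: "((\<lambda>r. (p - \<sigma> r) \<bullet> (p - \<sigma> r)) has_real_derivative - 2 * ((p - \<sigma> r) \<bullet> \<sigma>' r)) (at r)"
      by (simp add: has_field_derivative_def)
    have "- 2 * ((p - \<sigma> r) \<bullet> \<sigma>' r) = 0"
    proof (rule DERIV_local_min[OF D, of "min r (L - r)"])
      show "\<forall>y. \<bar>r - y\<bar> < min r (L - r) \<longrightarrow> (p - \<sigma> r) \<bullet> (p - \<sigma> r) \<le> (p - \<sigma> y) \<bullet> (p - \<sigma> y)"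
      proof (intro allI impI)
        fix y assume "\<bar>r - y\<bar> < min r (L - r)"
        then have "y \<in> {0..L}" by (auto simp: abs_less_iff)
        then have "norm (p - \<sigma> r) \<le> norm (p - \<sigma> y)" using r(2)[of y] by (simp add: dist_norm)
        then show "(p - \<sigma> r) \<bullet> (p - \<sigma> r) \<le> (p - \<sigma> y) \<bullet> (p - \<sigma> y)" by (simp add: norm_le)
      qed
    qed (use ri in auto)
    then have "(p - \<sigma> r) \<bullet> \<sigma>' r = 0" by simp
    then have pd: "p - \<sigma> r = ((p - \<sigma> r) \<bullet> \<nu> r) *\<^sub>R \<nu> r"
      using decompose_left_normal[OF unit[OF r(1)], of "p - \<sigma> r"] by simp
    have "\<bar>(p - \<sigma> r) \<bullet> \<nu> r\<bar> \<le> norm (p - \<sigma> r)"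
      using Cauchy_Schwarz_ineq2[of "p - \<sigma> r" "\<nu> r"] unit[OF r(1)] by simp
    then have "\<bar>(p - \<sigma> r) \<bullet> \<nu> r\<bar> < e" using le p by (simp add: dist_norm)
    moreover have "p = \<sigma> r + ((p - \<sigma> r) \<bullet> \<nu> r) *\<^sub>R \<nu> r" using pd by (simp add: algebra_simps)
    moreover have "\<bar>r - s\<bar> < e" using rs by (simp add: e'_def)
    ultimately show "\<exists>r d. \<bar>r - s\<bar> < e \<and> \<bar>d\<bar> < e \<and> p = \<sigma> r + d *\<^sub>R \<nu> r" by blast
  qed (use \<rho> e in auto)
qed

end

text \<open>
  An arc whose interior is the zero set of \<open>h\<close>, such that each of its points is approached by both
  signs of \<open>h\<close>. The gradient of \<open>h\<close> may vanish on the arc, so the sign of \<open>h\<close> on either side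
  comes from a connectedness argument.
\<close>

locale level_arc = regular_arc +
  fixes \<Omega> :: "(real \<times> real) set" and h :: "real \<times> real \<Rightarrow> real"
  assumes open_domain: "open \<Omega>"
    and cont_level: "continuous_on \<Omega> h"
    and level_set: "\<sigma> ` {0<..<L} = {p \<in> \<Omega>. h p = 0}"
    and both_signs: "\<sigma> ` {0<..<L} \<subseteq> closure {p \<in> \<Omega>. h p < 0} \<inter> closure {p \<in> \<Omega>. h p > 0}"
begin

text \<open>
  The normal segments of length \<open>e\<close> to the left of a short piece of the arc sweep out a connected set
  that misses the zero set of \<open>h\<close>, so \<open>h\<close> has one sign there, and likewise to the right. By
  \<open>foot_point\<close> the two sets cover a neighbourhood of \<open>\<sigma> s\<close> up to the arc. As both signs occur
  near \<open>\<sigma> s\<close>, the two sides have opposite signs.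
\<close>

lemma sides_local:
  assumes s: "s \<in> {0<..<L}"
  obtains e \<iota> where "e > 0" "\<iota> = 1 \<or> \<iota> = -1" "\<And>r. \<bar>r - s\<bar> < e \<Longrightarrow> r \<in> {0<..<L}"
    "\<And>r d. \<bar>r - s\<bar> < e \<Longrightarrow> 0 < d \<Longrightarrow> d < e \<Longrightarrow>
        0 < \<iota> * h (\<sigma> r + d *\<^sub>R \<nu> r) \<and> \<iota> * h (\<sigma> r - d *\<^sub>R \<nu> r) < 0"
proof -
  obtain e0 where e0: "e0 > 0" "\<And>r. \<bar>r - s\<bar> < e0 \<Longrightarrow> r \<in> {0<..<L}"
    "\<And>r d. \<bar>r - s\<bar> < e0 \<Longrightarrow> d \<noteq> 0 \<Longrightarrow> \<bar>d\<bar> < e0 \<Longrightarrow> \<sigma> r + d *\<^sub>R \<nu> r \<notin> \<sigma> ` {0..L}"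
    using normal_segment_off_arc[OF s] by blast
  have "\<sigma> s \<in> \<Omega>" using level_set s by auto
  then obtain \<rho> where \<rho>: "\<rho> > 0" "ball (\<sigma> s) \<rho> \<subseteq> \<Omega>" using open_domain openE by blast
  obtain e1 where e1: "e1 > 0" "\<And>r. \<bar>r - s\<bar> < e1 \<Longrightarrow> dist (\<sigma> r) (\<sigma> s) < \<rho>/2"
    using close_parameter[OF s half_gt_zero[OF \<rho>(1)]] by blast
  define e where "e = min e0 (min e1 (\<rho>/2))"
  have e: "e > 0" using e0 e1 \<rho> by (simp add: e_def)
  define F where "F = (\<lambda>(r, d). \<sigma> r + d *\<^sub>R \<nu> r)"
  have F\<Omega>: "F (r, d) \<in> \<Omega>" if "\<bar>r - s\<bar> < e" "\<bar>d\<bar> < e" for r d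
  proof -
    have "norm (\<sigma>' r) = 1" using e0(2)[of r] that unit by (auto simp: e_def)
    then have "dist (F (r, d)) (\<sigma> r) = \<bar>d\<bar>" by (simp add: F_def dist_norm)
    then have "dist (F (r, d)) (\<sigma> s) < \<rho>"
      using dist_triangle[of "F (r,d)" "\<sigma> s" "\<sigma> r"] e1(2)[of r] that by (simp add: e_def)
    then show ?thesis using \<rho>(2) by (auto simp: dist_commute)
  qed
  have hF: "h (F (r, d)) \<noteq> 0" if "\<bar>r - s\<bar> < e" "\<bar>d\<bar> < e" "d \<noteq> 0" for r d
  proof
    assume "h (F (r, d)) = 0"
    then have "F (r, d) \<in> \<sigma> ` {0<..<L}" using F\<Omega> that level_set by auto
    then show False using e0(3)[of r d] that by (force simp: F_def e_def)
  qed
  have sign: "(\<forall>x\<in>A. 0 < h (F x)) \<or> (\<forall>x\<in>A. h (F x) < 0)"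
    if A: "A = {s - e<..<s + e} \<times> J" "connected J" "\<And>d. d \<in> J \<Longrightarrow> \<bar>d\<bar> < e \<and> d \<noteq> 0" for A J
  proof (rule continuous_nonzero_sign)
    show "connected A" unfolding A(1) by (intro connected_Times A) simp
    have sub: "{s - e<..<s + e} \<subseteq> {0..L}"
    proof
      fix x assume "x \<in> {s - e<..<s + e}"
      then have "\<bar>x - s\<bar> < e0" by (auto simp: e_def abs_less_iff)
      from e0(2)[OF this] show "x \<in> {0..L}" by simp
    qed
    have "continuous_on A F"
      unfolding F_def A(1) case_prod_beta
      by (intro continuous_intros continuous_on_compose2[OF cont] continuous_on_compose2[OF cont_normal])
         (use sub in auto)
    then show "continuous_on A (\<lambda>x. h (F x))"
      by (rule continuous_on_compose2[OF cont_level])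
         (use F\<Omega> A in \<open>auto simp: abs_less_iff\<close>)
    show "h (F x) \<noteq> 0" if "x \<in> A" for x
      using hF[of "fst x" "snd x"] that A by (auto simp: abs_less_iff)
  qed
  obtain \<rho>' where \<rho>': "\<rho>' > 0"
    "\<And>p. dist p (\<sigma> s) < \<rho>' \<Longrightarrow> \<exists>r d. \<bar>r - s\<bar> < e \<and> \<bar>d\<bar> < e \<and> p = \<sigma> r + d *\<^sub>R \<nu> r"
    using foot_point[OF s e] by blast
  have covered: "\<exists>x\<in>{s - e<..<s + e} \<times> ({0<..<e} \<union> {-e<..<0}). p = F x"
    if p: "p \<in> \<Omega>" "h p \<noteq> 0" "dist p (\<sigma> s) < \<rho>'" for p
  proof -
    obtain r d where rd: "\<bar>r - s\<bar> < e" "\<bar>d\<bar> < e" "p = \<sigma> r + d *\<^sub>R \<nu> r" using \<rho>'(2)[OF p(3)] by blast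
    have "d \<noteq> 0"
    proof
      assume "d = 0"
      then have "p \<in> \<sigma> ` {0<..<L}" using rd e0(2)[of r] by (simp add: e_def)
      then show False using level_set p by auto
    qed
    then show ?thesis using rd
      by (intro bexI[of _ "(r, d)"]) (auto simp: F_def abs_less_iff)
  qed
  have "\<sigma> s \<in> closure {p \<in> \<Omega>. h p < 0}" "\<sigma> s \<in> closure {p \<in> \<Omega>. h p > 0}"
    using both_signs s by blast+
  then have "\<exists>p\<in>{p \<in> \<Omega>. h p < 0}. dist p (\<sigma> s) < \<rho>'" "\<exists>p\<in>{p \<in> \<Omega>. h p > 0}. dist p (\<sigma> s) < \<rho>'"
    using \<rho>'(1) by (simp_all only: closure_approachable)
  then obtain p1 p2 where p12: "p1 \<in> \<Omega>" "h p1 < 0" "dist p1 (\<sigma> s) < \<rho>'"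
     "p2 \<in> \<Omega>" "h p2 > 0" "dist p2 (\<sigma> s) < \<rho>'" by blast
  obtain x1 x2 where x: "x1 \<in> {s - e<..<s + e} \<times> ({0<..<e} \<union> {-e<..<0})" "h (F x1) < 0"
     "x2 \<in> {s - e<..<s + e} \<times> ({0<..<e} \<union> {-e<..<0})" "h (F x2) > 0"
    using covered[of p1] covered[of p2] p12 by auto
  let ?P = "{s - e<..<s + e} \<times> {0<..<e}" and ?M = "{s - e<..<s + e} \<times> {-e<..<0}"
  have P: "(\<forall>x\<in>?P. 0 < h (F x)) \<or> (\<forall>x\<in>?P. h (F x) < 0)" by (rule sign[OF refl]) auto
  have M: "(\<forall>x\<in>?M. 0 < h (F x)) \<or> (\<forall>x\<in>?M. h (F x) < 0)" by (rule sign[OF refl]) auto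
  have mem: "x1 \<in> ?P \<or> x1 \<in> ?M" "x2 \<in> ?P \<or> x2 \<in> ?M" using x by auto
  have not_pos: "\<not> ((\<forall>x\<in>?P. 0 < h (F x)) \<and> (\<forall>x\<in>?M. 0 < h (F x)))"
    using mem(1) less_not_sym[OF x(2)] by blast
  have not_neg: "\<not> ((\<forall>x\<in>?P. h (F x) < 0) \<and> (\<forall>x\<in>?M. h (F x) < 0))"
    using mem(2) less_not_sym[OF x(4)] by blast
  have "(\<forall>x\<in>?P. 0 < h (F x)) \<and> (\<forall>x\<in>?M. h (F x) < 0) \<or> (\<forall>x\<in>?P. h (F x) < 0) \<and> (\<forall>x\<in>?M. 0 < h (F x))"
    using P M not_pos not_neg by argo
  then obtain \<iota> :: real where \<iota>: "\<iota> = 1 \<or> \<iota> = -1" "\<forall>x\<in>?P. 0 < \<iota> * h (F x)" "\<forall>x\<in>?M. \<iota> * h (F x) < 0"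
  proof (elim disjE conjE)
    assume "\<forall>x\<in>?P. 0 < h (F x)" "\<forall>x\<in>?M. h (F x) < 0"
    then show ?thesis using that[of 1] by simp
  next
    assume "\<forall>x\<in>?P. h (F x) < 0" "\<forall>x\<in>?M. 0 < h (F x)"
    then show ?thesis using that[of "-1"] by simp
  qed
  show ?thesis
  proof (rule that[OF e \<iota>(1)])
    show "r \<in> {0<..<L}" if "\<bar>r - s\<bar> < e" for r using e0(2)[of r] that by (simp add: e_def)
    show "0 < \<iota> * h (\<sigma> r + d *\<^sub>R \<nu> r) \<and> \<iota> * h (\<sigma> r - d *\<^sub>R \<nu> r) < 0"
      if "\<bar>r - s\<bar> < e" "0 < d" "d < e" for r d
      using \<iota>(2)[rule_format, of "(r, d)"] \<iota>(3)[rule_format, of "(r, - d)"] that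
      by (auto simp: F_def abs_less_iff)
  qed
qed

text \<open>
  The parameters at which \<open>h\<close> is positive on the left and those at which it is positive on the
  right form disjoint open sets by \<open>sides_local\<close>, and the parameter interval is connected. The
  number \<open>\<iota> = \<plusminus> 1\<close> records which side is positive.
\<close>

lemma sides:
  obtains \<iota> where "\<iota> = 1 \<or> \<iota> = -1"
    "\<And>s. s \<in> {0<..<L} \<Longrightarrow> \<exists>e>0. \<forall>d. 0 < d \<and> d < e \<longrightarrow>
        0 < \<iota> * h (\<sigma> s + d *\<^sub>R \<nu> s) \<and> \<iota> * h (\<sigma> s - d *\<^sub>R \<nu> s) < 0"
proof -
  define Q where "Q = (\<lambda>\<iota> s. \<exists>e>0. \<forall>d. 0 < d \<and> d < e \<longrightarrow>
        0 < \<iota> * h (\<sigma> s + d *\<^sub>R \<nu> s) \<and> \<iota> * h (\<sigma> s - d *\<^sub>R \<nu> s) < 0)"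
  define A where "A = (\<lambda>\<iota>. {s \<in> {0<..<L}. Q \<iota> s})"
  have loc: "\<exists>\<iota> e. (\<iota> = 1 \<or> \<iota> = -1) \<and> e > 0 \<and> (\<forall>r. \<bar>r - s\<bar> < e \<longrightarrow> r \<in> A \<iota>)" if s: "s \<in> {0<..<L}" for s
  proof -
    obtain e \<iota> where eo: "e > 0" "\<iota> = 1 \<or> \<iota> = -1" "\<And>r. \<bar>r - s\<bar> < e \<Longrightarrow> r \<in> {0<..<L}"
    "\<And>r d. \<bar>r - s\<bar> < e \<Longrightarrow> 0 < d \<Longrightarrow> d < e \<Longrightarrow>
        0 < \<iota> * h (\<sigma> r + d *\<^sub>R \<nu> r) \<and> \<iota> * h (\<sigma> r - d *\<^sub>R \<nu> r) < 0"
      using sides_local[OF s] by blast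
    have "r \<in> A \<iota>" if "\<bar>r - s\<bar> < e" for r
      using eo that unfolding A_def Q_def by blast
    with eo show ?thesis by blast
  qed
  have disj: "A 1 \<inter> A (-1) = {}"
  proof (rule ccontr)
    assume "\<not> ?thesis"
    then obtain s where "Q 1 s" "Q (-1) s" by (auto simp: A_def)
    then obtain e1 e2 where "e1 > 0" "e2 > 0" "\<And>d. 0 < d \<Longrightarrow> d < e1 \<Longrightarrow> 0 < h (\<sigma> s + d *\<^sub>R \<nu> s)"
       "\<And>d. 0 < d \<Longrightarrow> d < e2 \<Longrightarrow> h (\<sigma> s + d *\<^sub>R \<nu> s) < 0"
      unfolding Q_def by auto
    then show False using field_lbound_gt_zero[of e1 e2] by (metis less_asym)
  qed
  have op: "open (A \<iota>)" if "\<iota> = 1 \<or> \<iota> = -1" for \<iota>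
    unfolding open_dist
  proof
    fix s assume s: "s \<in> A \<iota>"
    then obtain \<iota>' e where oe: "\<iota>' = 1 \<or> \<iota>' = -1" "e > 0" "\<forall>r. \<bar>r - s\<bar> < e \<longrightarrow> r \<in> A \<iota>'"
      using loc[of s] by (auto simp: A_def)
    then have "s \<in> A \<iota>'" by simp
    then have "\<iota>' = \<iota>" using disj s that oe(1) by auto
    with oe show "\<exists>e>0. \<forall>y. dist y s < e \<longrightarrow> y \<in> A \<iota>" by (auto simp: dist_real_def)
  qed
  have cov: "{0<..<L} \<subseteq> A 1 \<union> A (-1)"
  proof
    fix s assume "s \<in> {0<..<L}"
    then obtain \<iota>' e where oe: "\<iota>' = 1 \<or> \<iota>' = -1" "e > 0" "\<forall>r. \<bar>r - s\<bar> < e \<longrightarrow> r \<in> A \<iota>'"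
      using loc[of s] by auto
    then show "s \<in> A 1 \<union> A (-1)" by (metis UnCI abs_zero cancel_comm_monoid_add_class.diff_cancel)
  qed
  have "A 1 \<inter> {0<..<L} = {} \<or> A (-1) \<inter> {0<..<L} = {}"
    using connectedD[OF connected_Ioo[of 0 L] op op, of 1 "-1"] disj cov by auto
  then have "{0<..<L} \<subseteq> A 1 \<or> {0<..<L} \<subseteq> A (-1)" using cov by blast
  then obtain \<iota> where "\<iota> = 1 \<or> \<iota> = -1" "{0<..<L} \<subseteq> A \<iota>" by blast
  with that[of \<iota>] show ?thesis unfolding A_def Q_def by blast
qed

end

locale C2_arc = regular_arc +
  fixes \<sigma>''
  assumes deriv2: "\<And>s. s \<in> {0..L} \<Longrightarrow> (\<sigma>' has_vector_derivative \<sigma>'' s) (at s within {0..L})"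
    and cont2: "continuous_on {0..L} \<sigma>''"
begin

text \<open>
  Near a point with nonvertical tangent, a \<open>C\<^sup>2\<close> arc stays between two parabolas that touch its
  tangent line. Taylor's formula bounds the distance to the tangent by the square of the parameter
  difference, and that is comparable with the square of the horizontal distance.
\<close>

lemma quadratic_contact:
  assumes s: "s \<in> {0..L}" and \<tau>: "fst (\<sigma>' s) \<noteq> 0"
  defines "m \<equiv> snd (\<sigma>' s) / fst (\<sigma>' s)"
  shows "\<exists>K>0. \<exists>\<rho>>0. \<forall>r\<in>{0..L}. dist (\<sigma> r) (\<sigma> s) < \<rho> \<longrightarrow>
     \<bar>(snd (\<sigma> r) - snd (\<sigma> s)) - m * (fst (\<sigma> r) - fst (\<sigma> s))\<bar> \<le> K * (fst (\<sigma> r) - fst (\<sigma> s))\<^sup>2"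
proof -
  obtain M where M: "M > 0" "\<And>r. r \<in> {0..L} \<Longrightarrow> norm (\<sigma>'' r) \<le> M"
  proof -
    have "bounded (\<sigma>'' ` {0..L})"
      by (intro compact_imp_bounded compact_continuous_image cont2 compact_Icc)
    then show ?thesis using that unfolding bounded_pos by blast
  qed
  have taylor: "norm (\<sigma> r - \<sigma> s - (r - s) *\<^sub>R \<sigma>' s) \<le> M * \<bar>r - s\<bar>\<^sup>2" if r: "r \<in> {0..L}" for r
  proof -
    have sub: "closed_segment s r \<subseteq> {0..L}" using r s by (intro closed_segment_subset) auto
    have "norm (\<sigma> r - \<sigma> s - (r - s) *\<^sub>R \<sigma>' s) \<le> norm (r - s) * (M * \<bar>r - s\<bar>)"
    proof (rule vector_differentiable_bound_linearization[where S = "closed_segment s r"])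
      fix x assume x: "x \<in> closed_segment s r"
      show "(\<sigma> has_vector_derivative \<sigma>' x) (at x within closed_segment s r)"
        using has_vector_derivative_within_subset[OF deriv sub] x sub by blast
      have xL: "x \<in> {0..L}" using x sub by blast
      have "norm (\<sigma>' x - \<sigma>' s) \<le> M * norm (x - s)"
      proof (rule differentiable_bound[OF _ _ _ xL s])
        show "(\<sigma>' has_derivative (\<lambda>d. d *\<^sub>R \<sigma>'' t)) (at t within {0..L})" if "t \<in> {0..L}" for t
          using deriv2[OF that] by (simp add: has_vector_derivative_def)
        show "onorm (\<lambda>d. d *\<^sub>R \<sigma>'' t) \<le> M" if "t \<in> {0..L}" for t
        proof (rule onorm_le)
          show "norm (d *\<^sub>R \<sigma>'' t) \<le> M * norm d" for d
            using mult_left_mono[OF M(2)[OF that], of "\<bar>d\<bar>"] by (simp add: mult.commute)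
        qed
      qed simp
      also have "norm (x - s) \<le> \<bar>r - s\<bar>"
        using x by (auto simp: closed_segment_eq_real_ivl split: if_splits)
      finally show "norm (\<sigma>' x - \<sigma>' s) \<le> M * \<bar>r - s\<bar>" using M(1) by simp
    qed auto
    then show ?thesis by (simp add: power2_eq_square mult_ac)
  qed
  define \<tau> where "\<tau> = \<bar>fst (\<sigma>' s)\<bar>"
  have \<tau>: "\<tau> > 0" using \<tau> by (simp add: \<tau>_def)
  define e where "e = \<tau> / (2 * M)"
  have e: "e > 0" using \<tau> M by (simp add: e_def)
  define K where "K = 4 * (M * (1 + \<bar>m\<bar>)) / \<tau>\<^sup>2"
  have K: "K > 0" using M \<tau> by (simp add: K_def add_pos_nonneg)
  obtain \<rho> where \<rho>: "\<rho> > 0" "\<And>r. r \<in> {0..L} \<Longrightarrow> dist (\<sigma> r) (\<sigma> s) < \<rho> \<Longrightarrow> \<bar>r - s\<bar> < e"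
    using parameter_close[OF s e] by blast
  have "\<bar>(snd (\<sigma> r) - snd (\<sigma> s)) - m * (fst (\<sigma> r) - fst (\<sigma> s))\<bar> \<le> K * (fst (\<sigma> r) - fst (\<sigma> s))\<^sup>2"
    if r: "r \<in> {0..L}" "dist (\<sigma> r) (\<sigma> s) < \<rho>" for r
  proof -
    define X where "X = fst (\<sigma> r) - fst (\<sigma> s)"
    define Y where "Y = snd (\<sigma> r) - snd (\<sigma> s)"
    define d where "d = r - s"
    define E where "E = \<sigma> r - \<sigma> s - d *\<^sub>R \<sigma>' s"
    have E: "norm E \<le> M * \<bar>d\<bar>\<^sup>2" using taylor[OF r(1)] by (simp add: E_def d_def)
    have Ex: "\<bar>fst E\<bar> \<le> M * \<bar>d\<bar>\<^sup>2" and Ey: "\<bar>snd E\<bar> \<le> M * \<bar>d\<bar>\<^sup>2"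
      using E norm_fst_le[of "fst E" "snd E"] norm_snd_le[of "snd E" "fst E"] by auto
    have X: "X = d * fst (\<sigma>' s) + fst E" and Y: "Y = d * snd (\<sigma>' s) + snd E"
      by (simp_all add: E_def X_def Y_def)
    have "Y - m * X = snd E - m * fst E"
      using \<tau> by (simp add: X Y m_def \<tau>_def field_simps)
    also have "\<bar>\<dots>\<bar> \<le> \<bar>snd E\<bar> + \<bar>m\<bar> * \<bar>fst E\<bar>"
      by (metis abs_mult abs_triangle_ineq4)
    also have "\<dots> \<le> M * \<bar>d\<bar>\<^sup>2 + \<bar>m\<bar> * (M * \<bar>d\<bar>\<^sup>2)"
      using Ex Ey by (intro add_mono mult_left_mono) auto
    finally have 1: "\<bar>Y - m * X\<bar> \<le> (M * (1 + \<bar>m\<bar>)) * \<bar>d\<bar>\<^sup>2" by (simp add: algebra_simps)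
    have "\<bar>d\<bar> < e" using \<rho>(2)[OF r] by (simp add: d_def)
    then have "M * \<bar>d\<bar> \<le> \<tau> / 2" using M by (simp add: e_def field_simps)
    from mult_right_mono[OF this, of "\<bar>d\<bar>"] have "M * \<bar>d\<bar>\<^sup>2 \<le> \<bar>d\<bar> * \<tau> / 2"
      by (simp add: power2_eq_square mult_ac)
    moreover have "\<bar>d * fst (\<sigma>' s)\<bar> = \<bar>d\<bar> * \<tau>" by (simp add: \<tau>_def abs_mult)
    ultimately have "\<bar>d\<bar> * \<tau> / 2 \<le> \<bar>X\<bar>" using Ex unfolding X by linarith
    then have "(\<bar>d\<bar> * \<tau> / 2)\<^sup>2 \<le> \<bar>X\<bar>\<^sup>2" using \<tau> by (intro power_mono) auto
    then have "\<bar>d\<bar>\<^sup>2 \<le> 4 / \<tau>\<^sup>2 * X\<^sup>2" using \<tau> by (simp add: power_mult_distrib power_divide field_simps)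
    then have "(M * (1 + \<bar>m\<bar>)) * \<bar>d\<bar>\<^sup>2 \<le> (M * (1 + \<bar>m\<bar>)) * (4 / \<tau>\<^sup>2 * X\<^sup>2)"
      using M by (intro mult_left_mono) auto
    also have "\<dots> = K * X\<^sup>2" by (simp add: K_def)
    finally have "\<bar>Y - m * X\<bar> \<le> K * X\<^sup>2" using 1 by linarith
    then show ?thesis by (simp add: X_def Y_def)
  qed
  with K \<rho>(1) show ?thesis by blast
qed

end

section \<open>Plane potential flow near a sonic point\<close>

text \<open>
  The second partial derivatives are named such that irrotationality and the symmetry of second
  derivatives are built in: \<open>uy\<close> is also the \<open>x\<close>-derivative of \<open>v\<close>, and \<open>uyy\<close> is also the
  \<open>x\<close>-derivative of \<open>vy\<close>.
\<close>

locale potential_flow =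
  fixes \<gamma> :: real and \<Omega> :: "(real \<times> real) set"
    and u v ux uy vy uxx uxy uyy vyy :: "real \<times> real \<Rightarrow> real"
  assumes \<gamma>: "\<gamma> > 1"
    and open_\<Omega>: "open \<Omega>"
    and u: "\<And>p. p \<in> \<Omega> \<Longrightarrow> GDERIV u p :> (ux p, uy p)"
    and v: "\<And>p. p \<in> \<Omega> \<Longrightarrow> GDERIV v p :> (uy p, vy p)"
    and ux: "\<And>p. p \<in> \<Omega> \<Longrightarrow> GDERIV ux p :> (uxx p, uxy p)"
    and uy: "\<And>p. p \<in> \<Omega> \<Longrightarrow> GDERIV uy p :> (uxy p, uyy p)"
    and vy: "\<And>p. p \<in> \<Omega> \<Longrightarrow> GDERIV vy p :> (uyy p, vyy p)"
begin

text \<open>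
  The square of the local speed of sound, by Bernoulli's law.
\<close>

definition c2 :: "real \<times> real \<Rightarrow> real" where
  "c2 p = 1 - (\<gamma> - 1) / 2 * ((u p)\<^sup>2 + (v p)\<^sup>2)"

text \<open>
  The excess of the squared speed over its critical value: a smooth function that is negative in
  the subsonic, zero at sonic and positive in the supersonic points.
\<close>

definition excess :: "real \<times> real \<Rightarrow> real" where
  "excess p = (u p)\<^sup>2 + (v p)\<^sup>2 - 2 / (\<gamma> + 1)"

text \<open>
  \<open>A\<close>, \<open>2 B\<close> and \<open>C\<close> are the coefficients of the equation of motion in nondivergence form, and
  \<open>Ax\<close>, \<open>Bx\<close>, \<open>Cx\<close> are their \<open>x\<close>-derivatives.
\<close>

definition "A p = c2 p - (u p)\<^sup>2"
definition "B p = - (u p * v p)"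
definition "C p = c2 p - (v p)\<^sup>2"
definition "Ax p = - (\<gamma> - 1) * (u p * ux p + v p * uy p) - 2 * u p * ux p"
definition "Bx p = - (ux p * v p + u p * uy p)"
definition "Cx p = - (\<gamma> - 1) * (u p * ux p + v p * uy p) - 2 * v p * uy p"

lemmas coeff_defs = A_def B_def C_def Ax_def Bx_def Cx_def

text \<open>
  The critical speed is the one that equals its local speed of sound.
\<close>

lemma c2_excess: "c2 p - ((u p)\<^sup>2 + (v p)\<^sup>2) = - (\<gamma> + 1) / 2 * excess p"
  using \<gamma> by (simp add: c2_def excess_def field_simps)

text \<open>
  By \<open>c2_excess\<close>, the equation of motion is elliptic exactly at the subsonic points.
\<close>

lemma discriminant: "A p * C p - (B p)\<^sup>2 = c2 p * (c2 p - ((u p)\<^sup>2 + (v p)\<^sup>2))"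
  by (simp add: coeff_defs power2_eq_square algebra_simps)

lemma continuous_fields:
  "continuous_on \<Omega> u" "continuous_on \<Omega> v" "continuous_on \<Omega> ux" "continuous_on \<Omega> uy"
  by (rule GDERIV_continuous_on, erule u v ux uy)+

lemma continuous_coeffs:
  "continuous_on \<Omega> A" "continuous_on \<Omega> B" "continuous_on \<Omega> C"
  "continuous_on \<Omega> Ax" "continuous_on \<Omega> Bx" "continuous_on \<Omega> Cx" "continuous_on \<Omega> excess"
  unfolding coeff_defs c2_def excess_def by (intro continuous_intros continuous_fields)+

lemma GDERIV_coeffs:
  assumes "p \<in> \<Omega>"
  shows "\<exists>Ay. GDERIV A p :> (Ax p, Ay)" "\<exists>By. GDERIV B p :> (Bx p, By)" "\<exists>Cy. GDERIV C p :> (Cx p, Cy)"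
proof -
  note d = u[OF assms, unfolded gderiv_def] v[OF assms, unfolded gderiv_def]
  have "GDERIV c2 p :> (- (\<gamma> - 1) * (u p * ux p + v p * uy p), - (\<gamma> - 1) * (u p * uy p + v p * vy p))"
    unfolding gderiv_def c2_def[abs_def]
    by (rule derivative_eq_intros d refl | simp)+ (auto simp: fun_eq_iff inner_prod_def field_simps)
  note d = d this[unfolded gderiv_def]
  show "\<exists>Ay. GDERIV A p :> (Ax p, Ay)"
    by (rule exI[of _ "- (\<gamma> - 1) * (u p * uy p + v p * vy p) - 2 * u p * uy p"])
       (auto intro!: derivative_eq_intros d simp: gderiv_def coeff_defs[abs_def] inner_prod_def algebra_simps)
  show "\<exists>By. GDERIV B p :> (Bx p, By)"
    by (rule exI[of _ "- (uy p * v p + u p * vy p)"])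
       (auto intro!: derivative_eq_intros d simp: gderiv_def coeff_defs[abs_def] inner_prod_def algebra_simps)
  show "\<exists>Cy. GDERIV C p :> (Cx p, Cy)"
    by (rule exI[of _ "- (\<gamma> - 1) * (u p * uy p + v p * vy p) - 2 * v p * vy p"])
       (auto intro!: derivative_eq_intros d simp: gderiv_def coeff_defs[abs_def] inner_prod_def algebra_simps)
qed

end

locale gas_flow = potential_flow +
  assumes no_vacuum: "\<And>p. p \<in> \<Omega> \<Longrightarrow> 0 < c2 p"
    and gas: "\<And>p. p \<in> \<Omega> \<Longrightarrow> A p * ux p + 2 * B p * uy p + C p * vy p = 0"
begin

lemma differentiated_gas:
  assumes p: "p \<in> \<Omega>"
  shows "A p * uxx p + 2 * B p * uxy p + C p * uyy p + (Ax p * ux p + 2 * Bx p * uy p + Cx p * vy p) = 0"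
proof -
  obtain Ay By Cy where G: "GDERIV A p :> (Ax p, Ay)" "GDERIV B p :> (Bx p, By)" "GDERIV C p :> (Cx p, Cy)"
    using GDERIV_coeffs[OF p] by blast
  note d = G[unfolded gderiv_def] ux[OF p, unfolded gderiv_def] uy[OF p, unfolded gderiv_def]
    vy[OF p, unfolded gderiv_def]
  have "GDERIV (\<lambda>q. A q * ux q + 2 * B q * uy q + C q * vy q) p :>
     (A p * uxx p + Ax p * ux p + 2 * (B p * uxy p + Bx p * uy p) + (C p * uyy p + Cx p * vy p),
      A p * uxy p + Ay * ux p + 2 * (B p * uyy p + By * uy p) + (C p * vyy p + Cy * vy p))"
    by (auto intro!: derivative_eq_intros d simp: gderiv_def inner_prod_def algebra_simps)
  from GDERIV_unique_on_open[OF this GDERIV_const[of 0] open_\<Omega> p gas]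
  show ?thesis by (simp add: zero_prod_def algebra_simps)
qed

text \<open>
  Differentiating the equation of motion in \<open>x\<close> and eliminating \<open>vy\<close> by the equation itself leaves
  an equation for \<open>u\<close>. Its terms without second derivatives are all linear in the gradient of \<open>u\<close>
  once one factor is absorbed into the coefficient, so there is no term of order zero and the
  maximum principle applies.
\<close>

lemma u_equation:
  assumes p: "p \<in> \<Omega>" and C: "C p > 0"
  shows "uyy p + A p / C p * uxx p + 2 * B p / C p * uxy p
      + (Ax p - Cx p * A p / C p) / C p * ux p + (2 * Bx p - Cx p * (2 * B p) / C p) / C p * uy p = 0"
proof -
  have "vy p = - (A p * ux p + 2 * B p * uy p) / C p"
    using gas[OF p] C by (simp add: field_simps)
  with differentiated_gas[OF p] have
    "A p * uxx p + 2 * B p * uxy p + C p * uyy p + (Ax p * ux p + 2 * Bx p * uy p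
       + Cx p * (- (A p * ux p + 2 * B p * uy p) / C p)) = 0" by simp
  then have "(A p * uxx p + 2 * B p * uxy p + C p * uyy p + (Ax p * ux p + 2 * Bx p * uy p
       + Cx p * (- (A p * ux p + 2 * B p * uy p) / C p))) / C p = 0" by simp
  then show ?thesis using C by (simp add: add_divide_distrib diff_divide_distrib algebra_simps)
qed

end

text \<open>
  An arc of sonic points that separates subsonic from supersonic points.
\<close>

locale sonic_arc =
  C2_arc \<sigma> \<sigma>' L \<sigma>'' +
  gas_flow \<gamma> \<Omega> u v ux uy vy uxx uxy uyy vyy +
  level_arc \<sigma> \<sigma>' L \<Omega> "potential_flow.excess \<gamma> u v"
  for \<sigma> \<sigma>' \<sigma>'' :: "real \<Rightarrow> real \<times> real" and L \<gamma> :: real and \<Omega> :: "(real \<times> real) set"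
    and u v ux uy vy uxx uxy uyy vyy :: "real \<times> real \<Rightarrow> real"
begin

text \<open>
  At a sonic point with horizontal velocity \<open>A = B = 0\<close> and \<open>C > 0\<close>, so the equation for \<open>u\<close> reduces
  there to the second \<open>y\<close>-derivative and its coefficients are small nearby. In the subsonic region
  \<open>u \<le> q < c\<^sub>*\<close>, while \<open>u = c\<^sub>*\<close> at the point itself. The point is thus a strict maximum of \<open>u\<close> over
  a parabola region inside the subsonic region, and the boundary point lemma applies.
\<close>

lemma uy_nonzero_if_tangent_not_vertical:
  assumes s: "s \<in> {0<..<L}"
    and hor: "v (\<sigma> s) = 0" "u (\<sigma> s) > 0" and \<tau>: "fst (\<sigma>' s) \<noteq> 0"
  shows "uy (\<sigma> s) \<noteq> 0"
proof -
  obtain x0 y0 where p0: "\<sigma> s = (x0, y0)" by (cases "\<sigma> s")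
  have s': "s \<in> {0..L}" using s by simp
  have p0\<Omega>: "(x0, y0) \<in> \<Omega>" and ex0: "excess (x0, y0) = 0" using level_set s p0 by force+
  define t1 where "t1 = fst (\<sigma>' s)"
  define t2 where "t2 = snd (\<sigma>' s)"
  have t1: "t1 \<noteq> 0" using \<tau> by (simp add: t1_def)
  have t12: "t1\<^sup>2 + t2\<^sup>2 = 1" using unit[OF s'] by (simp add: t1_def t2_def norm_prod_def real_sqrt_eq_1_iff)
  define m where "m = t2 / t1"
  have "\<exists>K>0. \<exists>\<rho>>0. \<forall>r\<in>{0..L}. dist (\<sigma> r) (x0, y0) < \<rho> \<longrightarrow>
     \<bar>(snd (\<sigma> r) - y0) - m * (fst (\<sigma> r) - x0)\<bar> \<le> K * (fst (\<sigma> r) - x0)\<^sup>2"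
    using quadratic_contact[OF s' \<tau>] unfolding p0 m_def t1_def t2_def by simp
  then obtain K0 \<rho>1 where K0: "K0 > 0" and \<rho>1: "\<rho>1 > 0"
    and contact: "\<And>r. r \<in> {0..L} \<Longrightarrow> dist (\<sigma> r) (x0, y0) < \<rho>1 \<Longrightarrow>
     \<bar>(snd (\<sigma> r) - y0) - m * (fst (\<sigma> r) - x0)\<bar> \<le> K0 * (fst (\<sigma> r) - x0)\<^sup>2" by blast
  \<comment> \<open>the arc lies between the parabolas with coefficients \<open>K0\<close> and \<open>- K0\<close>, so a strictly narrower
      one meets it only at the point of contact\<close>
  define K where "K = K0 + 1"
  have K: "K > 0" using K0 by (simp add: K_def)
  obtain \<iota> where \<iota>: "\<iota> = 1 \<or> \<iota> = -1" and side:
    "\<And>s. s \<in> {0<..<L} \<Longrightarrow> \<exists>e>0. \<forall>d. 0 < d \<and> d < e \<longrightarrow>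
        0 < \<iota> * excess (\<sigma> s + d *\<^sub>R \<nu> s) \<and> \<iota> * excess (\<sigma> s - d *\<^sub>R \<nu> s) < 0"
    using sides by blast
  obtain e where e: "e > 0" "\<And>d. 0 < d \<Longrightarrow> d < e \<Longrightarrow>
        0 < \<iota> * excess (\<sigma> s + d *\<^sub>R \<nu> s) \<and> \<iota> * excess (\<sigma> s - d *\<^sub>R \<nu> s) < 0"
    using side[OF s] by blast
  \<comment> \<open>the parabola opens upwards or downwards, whichever points into the subsonic side\<close>
  define \<eta> where "\<eta> = - \<iota> * sgn t1"
  have \<eta>: "\<eta> = 1 \<or> \<eta> = -1" using \<iota> t1 by (auto simp: \<eta>_def sgn_if)
  define a where "a = (\<lambda>q. A q / C q)"
  define b where "b = (\<lambda>q. 2 * B q / C q)"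
  define b1 where "b1 = (\<lambda>q. (Ax q - Cx q * A q / C q) / C q)"
  define b2 where "b2 = (\<lambda>q. (2 * Bx q - Cx q * (2 * B q) / C q) / C q)"
  define D where "D = {q \<in> \<Omega>. 0 < C q}"
  have openD: "open D"
  proof -
    have "open (C -` {0<..} \<inter> \<Omega>)"
      using continuous_on_open_vimage[OF open_\<Omega>, of C] continuous_coeffs(3) by auto
    moreover have "C -` {0<..} \<inter> \<Omega> = D" by (auto simp: D_def)
    ultimately show ?thesis by simp
  qed
  have v0: "v (x0, y0) = 0" "u (x0, y0) > 0" using hor p0 by auto
  have c20: "c2 (x0, y0) = (u (x0, y0))\<^sup>2" using c2_excess[of "(x0,y0)"] ex0 v0 by simp
  have p0D: "(x0, y0) \<in> D" using p0\<Omega> no_vacuum[OF p0\<Omega>] v0 by (simp add: D_def C_def)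
  have sub: "D \<subseteq> \<Omega>" by (auto simp: D_def)
  have D0: "\<And>q. q \<in> D \<Longrightarrow> C q \<noteq> 0" by (auto simp: D_def)
  note cc = continuous_coeffs[THEN continuous_on_subset[OF _ sub]]
  have cont: "continuous_on D a" "continuous_on D b" "continuous_on D b1" "continuous_on D b2"
    unfolding a_def b_def b1_def b2_def by (intro continuous_intros cc ballI D0; assumption)+
  have at0: "a (x0, y0) = 0" "b (x0, y0) = 0"
    using v0 c20 by (simp_all add: a_def b_def A_def B_def)
  have near: "\<exists>r>0. \<forall>q. dist q (x0, y0) < r \<longrightarrow> q \<in> D \<and> \<bar>k q - k (x0, y0)\<bar> < \<epsilon>"
    if k: "continuous_on D k" and "\<epsilon> > 0" for k :: "real \<times> real \<Rightarrow> real" and \<epsilon>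
  proof -
    obtain r1 where r1: "r1 > 0" "ball (x0, y0) r1 \<subseteq> D" using openD p0D openE by blast
    obtain r2 where r2: "r2 > 0" "\<And>q. q \<in> D \<Longrightarrow> dist q (x0, y0) < r2 \<Longrightarrow> dist (k q) (k (x0, y0)) < \<epsilon>"
      using k[unfolded continuous_on_iff, rule_format, OF p0D \<open>\<epsilon> > 0\<close>] by blast
    have "q \<in> D \<and> \<bar>k q - k (x0, y0)\<bar> < \<epsilon>" if "dist q (x0, y0) < min r1 r2" for q
    proof -
      have "q \<in> D" using that r1(2) by (auto simp: dist_commute)
      then show ?thesis using r2(2)[of q] that by (simp add: dist_real_def)
    qed
    then show ?thesis using r1 r2 by (intro exI[of _ "min r1 r2"]) auto
  qed
  have m1: "1 + \<bar>m\<bar> \<noteq> 0" "\<bar>m\<bar> + 1 \<noteq> 0" by linarith+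
  define \<epsilon> where "\<epsilon> = 1 / (2 * (\<bar>m\<bar> + 1))"
  have \<epsilon>: "\<epsilon> > 0" by (simp add: \<epsilon>_def add_nonneg_pos)
  obtain ra where ra: "ra > 0" "\<And>q. dist q (x0, y0) < ra \<Longrightarrow> q \<in> D \<and> \<bar>a q - a (x0, y0)\<bar> < 1"
    using near[OF cont(1), of 1] by auto
  obtain rb where rb: "rb > 0" "\<And>q. dist q (x0, y0) < rb \<Longrightarrow> q \<in> D \<and> \<bar>b q - b (x0, y0)\<bar> < \<epsilon>"
    using near[OF cont(2) \<epsilon>] by auto
  obtain r1 where r1: "r1 > 0" "\<And>q. dist q (x0, y0) < r1 \<Longrightarrow> q \<in> D \<and> \<bar>b1 q - b1 (x0, y0)\<bar> < 1"
    using near[OF cont(3), of 1] by auto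
  obtain r2 where r2: "r2 > 0" "\<And>q. dist q (x0, y0) < r2 \<Longrightarrow> q \<in> D \<and> \<bar>b2 q - b2 (x0, y0)\<bar> < 1"
    using near[OF cont(4), of 1] by auto
  \<comment> \<open>on a ball of radius \<open>r\<close> all coefficients are under control; \<open>\<delta>\<close> makes the parabola
      region fit into it\<close>
  define r where "r = Min {\<rho>1, ra, rb, r1, r2, 1 / (2 * K)}"
  have r: "r > 0" using \<rho>1 ra rb r1 r2 K by (simp add: r_def)
  have rle: "r \<le> \<rho>1" "r \<le> ra" "r \<le> rb" "r \<le> r1" "r \<le> r2" "r \<le> 1 / (2 * K)" by (simp_all add: r_def)
  define CC where "CC = 2 * K + (\<bar>b1 (x0, y0)\<bar> + 1) * (\<bar>m\<bar> + 1) + (\<bar>b2 (x0, y0)\<bar> + 1)"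
  have CC: "CC > 0" using K by (simp add: CC_def add_pos_nonneg)
  define \<rho>2 where "\<rho>2 = r / (4 * (1 + \<bar>m\<bar>))"
  have \<rho>2: "\<rho>2 > 0" using r by (simp add: \<rho>2_def add_pos_nonneg)
  define \<delta> where "\<delta> = Min {r / 4, 1 / (6 * CC), K * \<rho>2\<^sup>2}"
  have \<delta>: "\<delta> > 0" using r CC K \<rho>2 by (simp add: \<delta>_def)
  have \<delta>le: "\<delta> \<le> r / 4" "\<delta> \<le> 1 / (6 * CC)" "\<delta> \<le> K * \<rho>2\<^sup>2" by (simp_all add: \<delta>_def)
  define N where "N = (\<lambda>q. \<eta> * ((snd q - y0) - m * (fst q - x0)))"
  define R where "R = {q. K * (fst q - x0)\<^sup>2 \<le> N q \<and> N q \<le> \<delta>}"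
  have RX: "\<bar>fst q - x0\<bar> \<le> \<rho>2" "\<bar>(snd q - y0) - m * (fst q - x0)\<bar> \<le> \<delta>" if "q \<in> R" for q
  proof -
    have q: "K * (fst q - x0)\<^sup>2 \<le> N q" "N q \<le> \<delta>" using that by (auto simp: R_def)
    have "0 \<le> K * (fst q - x0)\<^sup>2" using K by simp
    with q show "\<bar>(snd q - y0) - m * (fst q - x0)\<bar> \<le> \<delta>" using \<eta> by (auto simp: N_def)
    have "K * (fst q - x0)\<^sup>2 \<le> K * \<rho>2\<^sup>2" using q \<delta>le by linarith
    then have "(fst q - x0)\<^sup>2 \<le> \<rho>2\<^sup>2" using K by simp
    then show "\<bar>fst q - x0\<bar> \<le> \<rho>2" using \<rho>2 by (simp add: abs_le_square_iff[symmetric])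
  qed
  have cancel: "x * (r / (4 * x)) = r / 4" if "x \<noteq> 0" for x :: real using that by simp
  have Rball: "dist q (x0, y0) < r" if "q \<in> R" for q
  proof -
    define X where "X = fst q - x0"
    define Y where "Y = snd q - y0"
    have XY: "\<bar>X\<bar> \<le> \<rho>2" "\<bar>Y - m * X\<bar> \<le> \<delta>" using RX[OF that] by (auto simp: X_def Y_def)
    have "dist q (x0, y0) = sqrt (X\<^sup>2 + Y\<^sup>2)"
      by (cases q) (simp add: X_def Y_def dist_prod_def dist_real_def)
    also have "\<dots> \<le> \<bar>X\<bar> + \<bar>Y\<bar>" by (rule sqrt_sum_squares_le_sum_abs)
    also have "\<bar>Y\<bar> \<le> \<bar>Y - m * X\<bar> + \<bar>m * X\<bar>" by linarith
    also have "\<bar>X\<bar> + (\<bar>Y - m * X\<bar> + \<bar>m * X\<bar>) = (1 + \<bar>m\<bar>) * \<bar>X\<bar> + \<bar>Y - m * X\<bar>"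
      by (simp add: abs_mult algebra_simps)
    also have "\<dots> \<le> (1 + \<bar>m\<bar>) * \<rho>2 + r / 4"
      using XY \<delta>le by (intro add_mono mult_left_mono) auto
    also have "(1 + \<bar>m\<bar>) * \<rho>2 = r / 4" unfolding \<rho>2_def by (rule cancel[OF m1(1)])
    also have "r / 4 + r / 4 < r" using r by simp
    finally show ?thesis by simp
  qed
  have RD: "R \<subseteq> D" using Rball ra(2) rle(2) by (metis less_le_trans subsetI)
  have off: "excess q \<noteq> 0" if q: "q \<in> R" "q \<noteq> (x0, y0)" for q
  proof
    assume "excess q = 0"
    then have "q \<in> \<sigma> ` {0<..<L}" using level_set RD sub q by blast
    then obtain t where t: "t \<in> {0<..<L}" "q = \<sigma> t" by blast
    then have tL: "t \<in> {0..L}" by simp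
    have "\<bar>(snd q - y0) - m * (fst q - x0)\<bar> \<le> K0 * (fst q - x0)\<^sup>2"
      using contact[OF tL] Rball[OF q(1)] rle(1) t by simp
    then have "N q \<le> K0 * (fst q - x0)\<^sup>2" using \<eta> by (auto simp: N_def abs_le_iff)
    moreover have "K * (fst q - x0)\<^sup>2 \<le> N q" using q by (simp add: R_def)
    ultimately have "K * (fst q - x0)\<^sup>2 \<le> K0 * (fst q - x0)\<^sup>2" and Nq: "N q \<le> K0 * (fst q - x0)\<^sup>2"
        "K * (fst q - x0)\<^sup>2 \<le> N q" by linarith+
    then have "(fst q - x0)\<^sup>2 \<le> 0" by (simp add: K_def algebra_simps)
    then have "fst q = x0" by simp
    moreover from this Nq have "N q = 0" by simp
    then have "snd q = y0" using \<open>fst q = x0\<close> \<eta> by (auto simp: N_def)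
    ultimately show False using q(2) by (cases q) simp
  qed
  \<comment> \<open>a point on the normal segment into the subsonic side lies in the parabola region; one such
      point decides the sign of \<open>excess\<close> on the whole region, which is connected and misses the arc\<close>
  have sub_ref: "\<exists>q\<in>R - {(x0, y0)}. excess q < 0"
  proof -
    define d where "d = Min {e / 2, 1 / K, \<delta> * \<bar>t1\<bar>}"
    have d: "d > 0" using e K \<delta> t1 by (simp add: d_def)
    have dle: "d \<le> e / 2" "d \<le> 1 / K" "d \<le> \<delta> * \<bar>t1\<bar>" by (simp_all add: d_def)
    define q where "q = \<sigma> s - (\<iota> * d) *\<^sub>R \<nu> s"
    have "d < e" using dle(1) e(1) by simp
    from e(2)[OF d this] have exq: "excess q < 0" using \<iota> by (auto simp: q_def)
    have X: "fst q - x0 = \<iota> * d * t2" and Y: "snd q - y0 = - \<iota> * d * t1"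
      by (simp_all add: q_def p0 left_normal_def t1_def t2_def)
    have "N q = - \<iota> * \<eta> * d * (t1 + m * t2)" unfolding N_def X Y by (simp add: algebra_simps)
    also have "t1 + m * t2 = 1 / t1" using t12 t1 by (simp add: m_def field_simps power2_eq_square)
    also have "- \<iota> * \<eta> = sgn t1" using \<iota> by (auto simp: \<eta>_def)
    finally have Nq: "N q = d / \<bar>t1\<bar>" using t1 by (simp add: sgn_if)
    have "t1\<^sup>2 \<le> 1" "t2\<^sup>2 \<le> 1"
      using t12 zero_le_power2[of t1] zero_le_power2[of t2] by linarith+
    then have "\<bar>t1\<bar> \<le> 1" by (simp add: abs_square_le_1)
    have "K * (fst q - x0)\<^sup>2 = K * d\<^sup>2 * t2\<^sup>2" unfolding X using \<iota> by (auto simp: power_mult_distrib)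
    also have "\<dots> \<le> K * d\<^sup>2 * 1" using K \<open>t2\<^sup>2 \<le> 1\<close> by (intro mult_left_mono) auto
    also have "\<dots> = (K * d) * d" by (simp add: power2_eq_square)
    also have "\<dots> \<le> 1 * d" using dle(2) K d by (intro mult_right_mono) (auto simp: field_simps)
    also have "\<dots> \<le> d / \<bar>t1\<bar>" using \<open>\<bar>t1\<bar> \<le> 1\<close> t1 d by (simp add: field_simps)
    finally have "K * (fst q - x0)\<^sup>2 \<le> N q" by (simp add: Nq)
    moreover have "N q \<le> \<delta>" unfolding Nq using dle(3) t1 by (simp add: field_simps)
    ultimately have "q \<in> R" by (simp add: R_def)
    moreover have "q \<noteq> (x0, y0)" using exq ex0 by auto
    ultimately show ?thesis using exq by blast
  qed
  have neg_ex: "excess q < 0" if q: "q \<in> R" "q \<noteq> (x0, y0)" for q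
  proof -
    have "convex (R - {(x0, y0)})"
      unfolding R_def N_def using K \<eta> by (intro convex_parabola_region) auto
    then have "connected (R - {(x0, y0)})" by (rule convex_connected)
    moreover have "continuous_on (R - {(x0, y0)}) excess"
      by (rule continuous_on_subset[OF continuous_coeffs(7)]) (use RD sub in blast)
    ultimately have "(\<forall>x\<in>R - {(x0, y0)}. 0 < excess x) \<or> (\<forall>x\<in>R - {(x0, y0)}. excess x < 0)"
      by (rule continuous_nonzero_sign) (use off in blast)
    moreover obtain q' where q': "q' \<in> R - {(x0, y0)}" "excess q' < 0" using sub_ref by blast
    ultimately have "\<forall>x\<in>R - {(x0, y0)}. excess x < 0" using less_not_sym[OF q'(2)] q'(1) by blast
    then show ?thesis using q by blast
  qed
  have "\<eta> * uy (x0, y0) < 0"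
  proof (rule hopf_lemma_parabola[where w = u and wx = ux and wxx = uxx and wxy = uxy and wyy = uyy
        and a = a and b = b and ?b1.0 = b1 and ?b2.0 = b2 and \<Omega> = D and K = K and C = CC and \<delta> = \<delta> and m = m])
    show "\<eta> = 1 \<or> \<eta> = -1" by (rule \<eta>)
    show "K > 0" "\<delta> > 0" "CC > 0" "open D" by (fact K \<delta> CC openD)+
    show "6 * CC * \<delta> \<le> 1" using \<delta>le(2) CC by (simp add: field_simps)
    show "GDERIV u q :> (ux q, uy q)" "GDERIV ux q :> (uxx q, uxy q)" "GDERIV uy q :> (uxy q, uyy q)"
      if "q \<in> D" for q using u ux uy that sub by blast+
    show "{q. K * (fst q - x0)\<^sup>2 \<le> \<eta> * (snd q - y0 - m * (fst q - x0)) \<and>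
          \<eta> * (snd q - y0 - m * (fst q - x0)) \<le> \<delta>} \<subseteq> D"
      using RD by (simp add: R_def N_def)
    fix q assume "q \<in> {q. K * (fst q - x0)\<^sup>2 \<le> \<eta> * (snd q - y0 - m * (fst q - x0)) \<and>
          \<eta> * (snd q - y0 - m * (fst q - x0)) \<le> \<delta>}" and ne: "q \<noteq> (x0, y0)"
    then have qR: "q \<in> R" by (simp add: R_def N_def)
    have qD: "q \<in> D" using qR RD by blast
    then have q\<Omega>: "q \<in> \<Omega>" and Cq: "C q > 0" by (auto simp: D_def)
    have exq: "excess q < 0" by (rule neg_ex[OF qR ne])
    show "u q < u (x0, y0)"
    proof -
      have "(u q)\<^sup>2 < (u (x0, y0))\<^sup>2"
      proof -
        have "(u q)\<^sup>2 + (v q)\<^sup>2 < 2 / (\<gamma> + 1)" "(u (x0, y0))\<^sup>2 = 2 / (\<gamma> + 1)"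
          using exq ex0 v0 by (simp_all add: excess_def)
        moreover have "0 \<le> (v q)\<^sup>2" by simp
        ultimately show ?thesis by linarith
      qed
      then show ?thesis using v0(2) by (meson less_imp_le power2_less_imp_less)
    qed
    show "0 \<le> uyy q + a q * uxx q + b q * uxy q + b1 q * ux q + b2 q * uy q"
      using u_equation[OF q\<Omega> Cq] by (simp add: a_def b_def b1_def b2_def)
    show "(b q)\<^sup>2 \<le> 4 * a q"
    proof -
      have "0 < - (\<gamma> + 1) / 2 * excess q" using exq \<gamma> by (intro mult_neg_neg) auto
      then have "0 < c2 q * (c2 q - ((u q)\<^sup>2 + (v q)\<^sup>2))"
        unfolding c2_excess by (rule mult_pos_pos[OF no_vacuum[OF q\<Omega>]])
      then have "(B q)\<^sup>2 \<le> A q * C q" using discriminant[of q] by simp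
      then have "4 * ((B q)\<^sup>2 / (C q)\<^sup>2) \<le> 4 * (A q * C q / (C q)\<^sup>2)"
        by (intro mult_left_mono divide_right_mono) auto
      then show ?thesis using Cq by (simp add: a_def b_def power_divide power_mult_distrib power2_eq_square)
    qed
    then have aq0: "0 \<le> a q" using zero_le_power2[of "b q"] by linarith
    have dq: "dist q (x0, y0) < r" by (rule Rball[OF qR])
    let ?z = "- \<eta> * m - 2 * K * (fst q - x0)"
    have "\<bar>fst q - x0\<bar> \<le> r" using dist_fst_le[of q "(x0, y0)"] dq by (simp add: dist_real_def)
    also have "\<dots> \<le> 1 / (2 * K)" by (rule rle)
    finally have "2 * K * \<bar>fst q - x0\<bar> \<le> 1" using K by (simp add: field_simps)
    moreover have "\<bar>2 * K * (fst q - x0)\<bar> = 2 * K * \<bar>fst q - x0\<bar>"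
      unfolding abs_mult using K by simp
    ultimately have "\<bar>2 * K * (fst q - x0)\<bar> \<le> 1" by simp
    moreover have "\<bar>\<eta> * m\<bar> = \<bar>m\<bar>" using \<eta> by auto
    ultimately have z: "\<bar>?z\<bar> \<le> \<bar>m\<bar> + 1" by linarith
    have "\<bar>b q\<bar> \<le> \<epsilon>" using rb(2)[of q] dq rle(3) at0 by simp
    then have "\<bar>b q\<bar> * \<bar>?z\<bar> \<le> \<epsilon> * (\<bar>m\<bar> + 1)" using z \<epsilon> by (intro mult_mono) auto
    also have "\<dots> = 1 / 2" using m1 by (simp add: \<epsilon>_def)
    finally have "\<bar>b q * ?z * \<eta>\<bar> \<le> 1 / 2" using \<eta> by (auto simp: abs_mult)
    moreover have "0 \<le> a q * ?z\<^sup>2" using aq0 by simp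
    ultimately show "1 / 2 \<le> 1 + a q * ?z\<^sup>2 + b q * ?z * \<eta>" by linarith
    have "\<bar>a q\<bar> \<le> 1" using ra(2)[of q] dq rle(2) at0 by simp
    then have "2 * K * a q \<le> 2 * K * 1" using K by (intro mult_left_mono) auto
    moreover have "\<bar>b1 q\<bar> \<le> \<bar>b1 (x0, y0)\<bar> + 1" using r1(2)[of q] dq rle(4) by linarith
    then have "\<bar>b1 q * ?z\<bar> \<le> (\<bar>b1 (x0, y0)\<bar> + 1) * (\<bar>m\<bar> + 1)"
      unfolding abs_mult using z by (intro mult_mono) auto
    moreover have "\<bar>b2 q\<bar> \<le> \<bar>b2 (x0, y0)\<bar> + 1" using r2(2)[of q] dq rle(5) by linarith
    then have "\<bar>b2 q * \<eta>\<bar> \<le> \<bar>b2 (x0, y0)\<bar> + 1" using \<eta> by (auto simp: abs_mult)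
    ultimately show "- CC \<le> - 2 * K * a q + b1 q * ?z + b2 q * \<eta>"
      unfolding CC_def by linarith
  qed
  then show ?thesis by (auto simp: p0)
qed

end

section \<open>Rotation of the velocity along the sonic curve\<close>

text \<open>
  The angle is only assumed continuous. It is differentiable because, near \<open>s\<close>, it is
  \<open>\<Theta> s\<close> plus the arcsine of the sine of the difference, and that sine is bilinear in the
  velocities.
\<close>

lemma angle_has_derivative:
  fixes \<Theta> U V :: "real \<Rightarrow> real"
  assumes S: "open S" "s \<in> S" and cont: "continuous_on S \<Theta>" and q: "q > 0"
    and polar: "\<And>r. r \<in> S \<Longrightarrow> U r = q * cos (\<Theta> r)" "\<And>r. r \<in> S \<Longrightarrow> V r = q * sin (\<Theta> r)"
    and dU: "(U has_real_derivative dU) (at s)" and dV: "(V has_real_derivative dV) (at s)"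
  shows "(\<Theta> has_real_derivative (U s * dV - V s * dU) / q\<^sup>2) (at s)"
proof -
  define W where "W = (\<lambda>r. (U s * V r - V s * U r) / q\<^sup>2)"
  have W: "W r = sin (\<Theta> r - \<Theta> s)" if "r \<in> S" for r
    using q by (simp add: W_def polar[OF that] polar[OF S(2)] sin_diff power2_eq_square field_simps)
  have dW: "(W has_real_derivative (U s * dV - V s * dU) / q\<^sup>2) (at s)"
    unfolding W_def by (intro DERIV_cdivide DERIV_diff DERIV_cmult dU dV)
  have W0: "W s = 0" by (simp add: W_def)
  have "((\<lambda>r. \<Theta> s + arcsin (W r)) has_real_derivative (U s * dV - V s * dU) / q\<^sup>2) (at s)"
    using W0 by (auto intro!: derivative_eq_intros dW)
  moreover have "open (S \<inter> \<Theta> -` {\<Theta> s - pi/2<..<\<Theta> s + pi/2})"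
    using continuous_open_preimage[OF cont S(1), of "{\<Theta> s - pi/2<..<\<Theta> s + pi/2}"] by simp
  ultimately show ?thesis
  proof (rule has_field_derivative_transform_within_open)
    show "\<Theta> s + arcsin (W r) = \<Theta> r" if "r \<in> S \<inter> \<Theta> -` {\<Theta> s - pi/2<..<\<Theta> s + pi/2}" for r
      using that W[of r] by (simp add: arcsin_sin)
  qed (use S in auto)
qed

text \<open>
  Here \<open>(U, V)\<close> is the velocity, \<open>\<alpha>\<close>, \<open>\<beta>\<close>, \<open>\<kappa>\<close> are \<open>u\<^sub>x\<close>, \<open>u\<^sub>y = v\<^sub>x\<close>, \<open>v\<^sub>y\<close>, and \<open>(a, b)\<close> is the tangent.
  The sonic equation of motion says that \<open>(P, Q) = q\<^sup>2 \<nabla>\<theta>\<close> is parallel to \<open>(U, V)\<close>; constancy of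
  the speed says that \<open>(G1, G2) = \<nabla>q\<^sup>2 / 2\<close> is \<open>K\<close> times the left normal \<open>(- b, a)\<close>.
\<close>

lemma turning_identity:
  fixes U V \<alpha> \<beta> \<kappa> a b :: real
  assumes gas: "V\<^sup>2 * \<alpha> - 2 * (U * V) * \<beta> + U\<^sup>2 * \<kappa> = 0"
    and tangency: "U * (\<alpha> * a + \<beta> * b) + V * (\<beta> * a + \<kappa> * b) = 0"
    and unit: "a\<^sup>2 + b\<^sup>2 = 1"
  shows "(U * (\<beta> * a + \<kappa> * b) - V * (\<alpha> * a + \<beta> * b)) * (U\<^sup>2 + V\<^sup>2)
     = ((U * \<beta> + V * \<kappa>) * a - (U * \<alpha> + V * \<beta>) * b) * (U * a + V * b)\<^sup>2"
proof -
  define P where "P = U * \<beta> - V * \<alpha>"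
  define Q where "Q = U * \<kappa> - V * \<beta>"
  define G1 where "G1 = U * \<alpha> + V * \<beta>"
  define G2 where "G2 = U * \<beta> + V * \<kappa>"
  define K where "K = G2 * a - G1 * b"
  have PQ: "V * P = U * Q" using gas by (simp add: P_def Q_def power2_eq_square algebra_simps)
  have G: "G1 * a + G2 * b = 0" using tangency by (simp add: G1_def G2_def algebra_simps)
  have "- K * b = G1 * b\<^sup>2 - (G2 * b) * a" by (simp add: K_def power2_eq_square algebra_simps)
  also have "G2 * b = - G1 * a" using G by simp
  also have "G1 * b\<^sup>2 - (- G1 * a) * a = G1 * (a\<^sup>2 + b\<^sup>2)" by (simp add: power2_eq_square algebra_simps)
  finally have G1: "G1 = - K * b" using unit by simp
  have "K * a = G2 * a\<^sup>2 - (G1 * a) * b" by (simp add: K_def power2_eq_square algebra_simps)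
  also have "G1 * a = - G2 * b" using G by simp
  also have "G2 * a\<^sup>2 - (- G2 * b) * b = G2 * (a\<^sup>2 + b\<^sup>2)" by (simp add: power2_eq_square algebra_simps)
  finally have G2: "G2 = K * a" using unit by simp
  have "U * P + V * Q = U * G2 - V * G1"
    by (simp add: P_def Q_def G1_def G2_def algebra_simps)
  also have "\<dots> = K * (U * a + V * b)" by (simp add: G1 G2 algebra_simps)
  finally have UP: "U * P + V * Q = K * (U * a + V * b)" .
  have "(a * P + b * Q) * (U\<^sup>2 + V\<^sup>2) = a * P * U\<^sup>2 + a * V * (V * P) + b * U * (U * Q) + b * Q * V\<^sup>2"
    by (simp add: power2_eq_square algebra_simps)
  also have "\<dots> = a * P * U\<^sup>2 + a * V * (U * Q) + b * U * (V * P) + b * Q * V\<^sup>2" by (simp only: PQ)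
  also have "\<dots> = (U * a + V * b) * (U * P + V * Q)" by (simp add: power2_eq_square algebra_simps)
  also have "\<dots> = K * (U * a + V * b)\<^sup>2" by (simp add: UP power2_eq_square)
  finally show ?thesis
    by (simp add: K_def G1_def G2_def P_def Q_def algebra_simps)
qed

context sonic_arc
begin

text \<open>
  Half the derivative of the squared speed in the direction of the left normal.
\<close>

definition side_rate :: "real \<Rightarrow> real" where
  "side_rate s = (u (\<sigma> s) * uy (\<sigma> s) + v (\<sigma> s) * vy (\<sigma> s)) * fst (\<sigma>' s)
               - (u (\<sigma> s) * ux (\<sigma> s) + v (\<sigma> s) * uy (\<sigma> s)) * snd (\<sigma>' s)"

lemma sonic: assumes "s \<in> {0<..<L}" shows "\<sigma> s \<in> \<Omega>" "excess (\<sigma> s) = 0"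
  using level_set assms by auto

lemma derivs_along:
  assumes s: "s \<in> {0<..<L}"
  shows "((\<lambda>r. u (\<sigma> r)) has_real_derivative ux (\<sigma> s) * fst (\<sigma>' s) + uy (\<sigma> s) * snd (\<sigma>' s)) (at s)"
    and "((\<lambda>r. v (\<sigma> r)) has_real_derivative uy (\<sigma> s) * fst (\<sigma>' s) + vy (\<sigma> s) * snd (\<sigma>' s)) (at s)"
  using GDERIV_along_curve[OF u[OF sonic(1)[OF s]] deriv_interior[OF s]]
    GDERIV_along_curve[OF v[OF sonic(1)[OF s]] deriv_interior[OF s]]
  by (simp_all add: inner_prod_def)

lemma GDERIV_excess:
  assumes "p \<in> \<Omega>"
  shows "GDERIV excess p :> (2 * (u p * ux p + v p * uy p), 2 * (u p * uy p + v p * vy p))"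
  unfolding gderiv_def excess_def[abs_def]
  by (auto intro!: derivative_eq_intros u[OF assms, unfolded gderiv_def] v[OF assms, unfolded gderiv_def]
     simp: inner_prod_def algebra_simps)

text \<open>
  At a sonic point \<open>c2\<close> is \<open>u\<^sup>2 + v\<^sup>2\<close>, which turns the coefficients \<open>A\<close>, \<open>B\<close>, \<open>C\<close> into
  \<open>v\<^sup>2\<close>, \<open>- u v\<close>, \<open>u\<^sup>2\<close>; the second hypothesis of \<open>turning_identity\<close> holds since \<open>excess\<close> vanishes
  along the arc.
\<close>

lemma turning:
  assumes s: "s \<in> {0<..<L}"
  shows "(u (\<sigma> s) * (uy (\<sigma> s) * fst (\<sigma>' s) + vy (\<sigma> s) * snd (\<sigma>' s))
        - v (\<sigma> s) * (ux (\<sigma> s) * fst (\<sigma>' s) + uy (\<sigma> s) * snd (\<sigma>' s))) * ((u (\<sigma> s))\<^sup>2 + (v (\<sigma> s))\<^sup>2)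
      = side_rate s * ((u (\<sigma> s), v (\<sigma> s)) \<bullet> \<sigma>' s)\<^sup>2"
proof -
  let ?p = "\<sigma> s"
  note p = sonic[OF s]
  have c2: "c2 ?p = (u ?p)\<^sup>2 + (v ?p)\<^sup>2" using c2_excess[of ?p] p(2) by simp
  have 1: "(v ?p)\<^sup>2 * ux ?p - 2 * (u ?p * v ?p) * uy ?p + (u ?p)\<^sup>2 * vy ?p = 0"
    using gas[OF p(1)] by (simp add: A_def B_def C_def c2)
  have "((\<lambda>r. excess (\<sigma> r)) has_real_derivative
     (2 * (u ?p * ux ?p + v ?p * uy ?p), 2 * (u ?p * uy ?p + v ?p * vy ?p)) \<bullet> \<sigma>' s) (at s)"
    by (rule GDERIV_along_curve[OF GDERIV_excess[OF p(1)] deriv_interior[OF s]])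
  moreover have "((\<lambda>r. excess (\<sigma> r)) has_real_derivative 0) (at s)"
    by (rule has_field_derivative_transform_within_open[where f = "\<lambda>_. 0" and S = "{0<..<L}"])
       (use s sonic(2) in auto)
  ultimately have "(2 * (u ?p * ux ?p + v ?p * uy ?p), 2 * (u ?p * uy ?p + v ?p * vy ?p)) \<bullet> \<sigma>' s = 0"
    by (rule DERIV_unique)
  then have 2: "u ?p * (ux ?p * fst (\<sigma>' s) + uy ?p * snd (\<sigma>' s)) + v ?p * (uy ?p * fst (\<sigma>' s) + vy ?p * snd (\<sigma>' s)) = 0"
    by (simp add: inner_prod_def algebra_simps)
  have 3: "(fst (\<sigma>' s))\<^sup>2 + (snd (\<sigma>' s))\<^sup>2 = 1"
    using unit[of s] s by (simp add: norm_prod_def real_sqrt_eq_1_iff)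
  show ?thesis
    using turning_identity[OF 1 2 3] by (simp add: side_rate_def inner_prod_def)
qed

text \<open>
  The supersonic region stays on one side of the arc by \<open>sides\<close>, and \<open>excess\<close> grows from zero
  in that direction.
\<close>

lemma side_rate_sign:
  obtains \<iota> where "\<iota> = 1 \<or> \<iota> = -1" "\<And>s. s \<in> {0<..<L} \<Longrightarrow> 0 \<le> \<iota> * side_rate s"
proof -
  obtain \<iota> where \<iota>: "\<iota> = 1 \<or> \<iota> = -1" and side:
    "\<And>s. s \<in> {0<..<L} \<Longrightarrow> \<exists>e>0. \<forall>d. 0 < d \<and> d < e \<longrightarrow>
        0 < \<iota> * excess (\<sigma> s + d *\<^sub>R \<nu> s) \<and> \<iota> * excess (\<sigma> s - d *\<^sub>R \<nu> s) < 0"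
    using sides by blast
  show ?thesis
  proof (rule that[OF \<iota>])
    fix s assume s: "s \<in> {0<..<L}"
    let ?p = "\<sigma> s"
    obtain e where e: "e > 0" "\<And>d. 0 < d \<Longrightarrow> d < e \<Longrightarrow> 0 < \<iota> * excess (\<sigma> s + d *\<^sub>R \<nu> s)"
      using side[OF s] by blast
    have "GDERIV excess (\<sigma> s + 0 *\<^sub>R \<nu> s) :>
       (2 * (u ?p * ux ?p + v ?p * uy ?p), 2 * (u ?p * uy ?p + v ?p * vy ?p))"
      using GDERIV_excess[OF sonic(1)[OF s]] by simp
    from DERIV_cmult[OF GDERIV_along_line[OF this], of \<iota>]
    have D: "((\<lambda>d. \<iota> * excess (\<sigma> s + d *\<^sub>R \<nu> s)) has_real_derivative 2 * (\<iota> * side_rate s)) (at 0)"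
      by (simp add: side_rate_def left_normal_def inner_prod_def algebra_simps)
    show "0 \<le> \<iota> * side_rate s"
    proof (rule ccontr)
      assume "\<not> ?thesis"
      then obtain d where d: "d > 0" "\<And>h. 0 < h \<Longrightarrow> h < d \<Longrightarrow>
          \<iota> * excess (\<sigma> s + (0 + h) *\<^sub>R \<nu> s) < \<iota> * excess (\<sigma> s + 0 *\<^sub>R \<nu> s)"
        using DERIV_neg_dec_right[OF D] by auto
      define h where "h = min d e / 2"
      have "0 < h" "h < d" "h < e" using d e by (auto simp: h_def)
      then show False using d(2)[of h] e(2)[of h] sonic(2)[OF s] by simp
    qed
  qed
qed

end

locale sonic_arc_angle = sonic_arc +
  fixes \<theta> :: "real \<times> real \<Rightarrow> real"
  assumes cont_angle: "continuous_on {0..L} (\<lambda>s. \<theta> (\<sigma> s))"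
    and polar: "\<And>s. s \<in> {0..L} \<Longrightarrow>
       (u (\<sigma> s), v (\<sigma> s)) = sqrt (2 / (\<gamma> + 1)) *\<^sub>R (cos (\<theta> (\<sigma> s)), sin (\<theta> (\<sigma> s)))"
begin

lemma critical_speed_pos: "0 < sqrt (2 / (\<gamma> + 1))"
  using \<gamma> by simp

lemma angle_derivative:
  assumes s: "s \<in> {0<..<L}"
  shows "((\<lambda>r. \<theta> (\<sigma> r)) has_real_derivative
     side_rate s * ((u (\<sigma> s), v (\<sigma> s)) \<bullet> \<sigma>' s)\<^sup>2 / (2 / (\<gamma> + 1))\<^sup>2) (at s)"
proof -
  let ?N = "u (\<sigma> s) * (uy (\<sigma> s) * fst (\<sigma>' s) + vy (\<sigma> s) * snd (\<sigma>' s))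
        - v (\<sigma> s) * (ux (\<sigma> s) * fst (\<sigma>' s) + uy (\<sigma> s) * snd (\<sigma>' s))"
  have divide: "n / c = x / c\<^sup>2" if "n * c = x" "c \<noteq> 0" for n c x :: real
    using that by (auto simp: power2_eq_square)
  have "((\<lambda>r. \<theta> (\<sigma> r)) has_real_derivative ?N / (sqrt (2 / (\<gamma> + 1)))\<^sup>2) (at s)"
    by (rule angle_has_derivative[where S = "{0<..<L}", OF _ s _ critical_speed_pos _ _ derivs_along[OF s]])
       (use polar in \<open>auto intro: continuous_on_subset[OF cont_angle]\<close>)
  moreover have "(sqrt (2 / (\<gamma> + 1)))\<^sup>2 = 2 / (\<gamma> + 1)" using \<gamma> by simp
  moreover have "(u (\<sigma> s))\<^sup>2 + (v (\<sigma> s))\<^sup>2 = 2 / (\<gamma> + 1)" using sonic(2)[OF s] by (simp add: excess_def)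
  then have "?N * (2 / (\<gamma> + 1)) = side_rate s * ((u (\<sigma> s), v (\<sigma> s)) \<bullet> \<sigma>' s)\<^sup>2"
    using turning[OF s] by simp
  then have "?N / (2 / (\<gamma> + 1)) = side_rate s * ((u (\<sigma> s), v (\<sigma> s)) \<bullet> \<sigma>' s)\<^sup>2 / (2 / (\<gamma> + 1))\<^sup>2"
    by (rule divide) (use \<gamma> in simp)
  ultimately show ?thesis by simp
qed

text \<open>
  By \<open>angle_derivative\<close> and \<open>side_rate_sign\<close> the angle is monotone along the arc.
\<close>

lemma angle_zero_if_ends_zero:
  assumes ends: "\<theta> (\<sigma> 0) = 0" "\<theta> (\<sigma> L) = 0" and s: "s \<in> {0..L}"
  shows "\<theta> (\<sigma> s) = 0"
proof -
  obtain \<iota> where \<iota>: "\<iota> = 1 \<or> \<iota> = -1" "\<And>s. s \<in> {0<..<L} \<Longrightarrow> 0 \<le> \<iota> * side_rate s"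
    using side_rate_sign by blast
  have mono: "\<iota> * \<theta> (\<sigma> a) \<le> \<iota> * \<theta> (\<sigma> b)" if ab: "0 \<le> a" "a \<le> b" "b \<le> L" for a b
  proof (rule DERIV_nonneg_imp_increasing_open[OF ab(2)])
    fix x assume "a < x" "x < b"
    then have x: "x \<in> {0<..<L}" using ab by auto
    have "0 \<le> (\<iota> * side_rate x) * (((u (\<sigma> x), v (\<sigma> x)) \<bullet> \<sigma>' x)\<^sup>2 / (2 / (\<gamma> + 1))\<^sup>2)"
      by (rule mult_nonneg_nonneg[OF \<iota>(2)[OF x]]) simp
    then show "\<exists>y. ((\<lambda>s. \<iota> * \<theta> (\<sigma> s)) has_real_derivative y) (at x) \<and> 0 \<le> y"
      using DERIV_cmult[OF angle_derivative[OF x], of \<iota>] by (auto simp: mult.assoc)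
  next
    show "continuous_on {a..b} (\<lambda>s. \<iota> * \<theta> (\<sigma> s))"
      using ab by (intro continuous_intros continuous_on_subset[OF cont_angle]) auto
  qed
  have "\<iota> * \<theta> (\<sigma> s) = 0" using mono[of 0 s] mono[of s L] s ends by simp
  then show ?thesis using \<iota>(1) by auto
qed

lemma angle_constant_if_normal:
  assumes "\<And>s. s \<in> {0<..<L} \<Longrightarrow> (u (\<sigma> s), v (\<sigma> s)) \<bullet> \<sigma>' s = 0" and s: "s \<in> {0..L}"
  shows "\<theta> (\<sigma> s) = \<theta> (\<sigma> 0)"
proof (rule DERIV_isconst2[OF L_pos cont_angle])
  fix x assume "0 < x" "x < L"
  then have x: "x \<in> {0<..<L}" by simp
  show "((\<lambda>s. \<theta> (\<sigma> s)) has_real_derivative 0) (at x)"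
    using angle_derivative[OF x] assms(1)[OF x] by simp
qed (use s in auto)

lemma velocity_if_angle_zero:
  assumes "s \<in> {0..L}" "\<theta> (\<sigma> s) = 0"
  shows "u (\<sigma> s) = sqrt (2 / (\<gamma> + 1))" "v (\<sigma> s) = 0"
  using polar[OF assms(1)] assms(2) by auto

text \<open>
  Along the arc \<open>v\<close> vanishes, so \<open>uy\<close> (the \<open>x\<close>-derivative of \<open>v\<close>) and \<open>vy\<close> satisfy
  \<open>uy \<tau>\<^sub>1 + vy \<tau>\<^sub>2 = 0\<close>, where \<open>vy = 0\<close> by the equation of motion. So \<open>uy = 0\<close> wherever the tangent
  is not vertical, which \<open>uy_nonzero_if_tangent_not_vertical\<close> forbids. The endpoints follow by
  continuity.
\<close>

lemma tangent_vertical_if_angle_zero: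
  assumes zero: "\<And>s. s \<in> {0..L} \<Longrightarrow> \<theta> (\<sigma> s) = 0" and s: "s \<in> {0..L}"
  shows "fst (\<sigma>' s) = 0"
proof -
  have int: "fst (\<sigma>' s) = 0" if s: "s \<in> {0<..<L}" for s
  proof (rule ccontr)
    assume tang: "fst (\<sigma>' s) \<noteq> 0"
    let ?p = "\<sigma> s"
    have uv: "u (\<sigma> r) = sqrt (2 / (\<gamma> + 1))" "v (\<sigma> r) = 0" if "r \<in> {0<..<L}" for r
      using velocity_if_angle_zero[of r] zero[of r] that by auto
    have u0: "u ?p > 0" using uv[OF s] critical_speed_pos by simp
    have "((\<lambda>r. v (\<sigma> r)) has_real_derivative 0) (at s)"
      by (rule has_field_derivative_transform_within_open[where f = "\<lambda>_. 0" and S = "{0<..<L}"])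
         (use s uv in auto)
    then have "uy ?p * fst (\<sigma>' s) + vy ?p * snd (\<sigma>' s) = 0"
      using DERIV_unique[OF derivs_along(2)[OF s]] by blast
    moreover have "vy ?p = 0"
    proof -
      have "c2 ?p = (u ?p)\<^sup>2" using c2_excess[of ?p] sonic(2)[OF s] uv(2)[OF s] by simp
      then show ?thesis using gas[OF sonic(1)[OF s]] uv(2)[OF s] u0 by (simp add: A_def B_def C_def)
    qed
    ultimately have "uy ?p = 0" using tang by simp
    then show False
      using uy_nonzero_if_tangent_not_vertical[OF s uv(2)[OF s] u0 tang] by simp
  qed
  have "closure {0<..<L} = {0..L}" using L_pos by simp
  moreover have "continuous_on {0..L} (\<lambda>s. fst (\<sigma>' s))" by (intro continuous_intros cont_tangent)
  ultimately show ?thesis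
    using continuous_constant_on_closure[of "{0<..<L}" "\<lambda>s. fst (\<sigma>' s)" 0 s] int s by auto
qed

end

section \<open>Sonic curves in a de Laval nozzle\<close>

lemma partials_of_GDERIV:
  assumes "GDERIV h p :> (a, b)"
  shows "partial_x h p = a" "partial_y h p = b"
proof -
  have "((\<lambda>r. h ((0, snd p) + r *\<^sub>R (1, 0))) has_real_derivative (a, b) \<bullet> (1, 0)) (at (fst p))"
    by (rule GDERIV_along_line) (use assms in simp)
  then show "partial_x h p = a" by (auto simp: partial_x_def intro!: DERIV_imp_deriv)
  have "((\<lambda>r. h ((fst p, 0) + r *\<^sub>R (0, 1))) has_real_derivative (a, b) \<bullet> (0, 1)) (at (snd p))"
    by (rule GDERIV_along_line) (use assms in simp)
  then show "partial_y h p = b" by (auto simp: partial_y_def intro!: DERIV_imp_deriv)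
qed

lemma Ck_closure_2_derivatives:
  assumes h: "Ck_closure 2 \<Omega> h" and \<Omega>: "open \<Omega>"
  shows "\<exists>hx hy hxx hxy hyy. \<forall>p\<in>\<Omega>. GDERIV h p :> (hx p, hy p) \<and>
    GDERIV hx p :> (hxx p, hxy p) \<and> GDERIV hy p :> (hxy p, hyy p)"
proof -
  obtain hx hy where 1: "Ck_closure (Suc 0) \<Omega> hx" "Ck_closure (Suc 0) \<Omega> hy"
    "\<And>p. p \<in> \<Omega> \<Longrightarrow> GDERIV h p :> (hx p, hy p)"
    using h unfolding numeral_2_eq_2 Ck_closure.simps(2)[of "Suc 0"] by blast
  obtain hxx hxy where 2: "continuous_on (closure \<Omega>) hxy"
    "\<And>p. p \<in> \<Omega> \<Longrightarrow> GDERIV hx p :> (hxx p, hxy p)"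
    using 1(1) unfolding Ck_closure.simps by blast
  obtain hyx hyy where 3: "continuous_on (closure \<Omega>) hyx"
    "\<And>p. p \<in> \<Omega> \<Longrightarrow> GDERIV hy p :> (hyx p, hyy p)"
    using 1(2) unfolding Ck_closure.simps by blast
  have "hxy p = hyx p" if "p \<in> \<Omega>" for p
    by (rule mixed_partials_eq[OF \<Omega> that 1(3) 2(2) 3(2)])
       (auto intro: continuous_on_subset[OF 2(1)] continuous_on_subset[OF 3(1)] closure_subset[THEN subsetD])
  then have "\<forall>p\<in>\<Omega>. GDERIV h p :> (hx p, hy p) \<and>
    GDERIV hx p :> (hxx p, hxy p) \<and> GDERIV hy p :> (hxy p, hyy p)"
    using 1(3) 2(2) 3(2) by simp
  then show ?thesis by blast
qed

text \<open>
  Conservation of mass, divided by \<open>\<rho> / c\<^sup>2\<close>; this uses \<open>\<rho>'(s) = - \<rho> / (2 c\<^sup>2)\<close> for the density as a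
  function of the squared speed.
\<close>

lemma nondivergence_form:
  assumes \<gamma>: "\<gamma> > 1"
    and u: "GDERIV u p :> (ux, uy)" and v: "GDERIV v p :> (vx, vy)"
    and c2: "0 < 1 - (\<gamma> - 1) / 2 * ((u p)\<^sup>2 + (v p)\<^sup>2)" (is "0 < ?c")
    and mass: "partial_x (\<lambda>z. density \<gamma> ((u z)\<^sup>2 + (v z)\<^sup>2) * u z) p
            + partial_y (\<lambda>z. density \<gamma> ((u z)\<^sup>2 + (v z)\<^sup>2) * v z) p = 0"
  shows "(?c - (u p)\<^sup>2) * ux - u p * v p * (uy + vx) + (?c - (v p)\<^sup>2) * vy = 0"
proof -
  define e where "e = 1 / (\<gamma> - 1)"
  \<comment> \<open>\<open>R = \<rho> / c\<^sup>2\<close>\<close>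
  define R where "R = ?c powr (e - 1)"
  have R: "R > 0" using c2 by (simp add: R_def)
  have e: "e * (\<gamma> - 1) = 1" using \<gamma> by (simp add: e_def)
  have \<rho>: "density \<gamma> ((u p)\<^sup>2 + (v p)\<^sup>2) = ?c * R"
    using c2 by (simp add: density_def R_def e_def powr_mult_base)
  have base: "GDERIV (\<lambda>z. 1 - (\<gamma> - 1) / 2 * ((u z)\<^sup>2 + (v z)\<^sup>2)) p :>
      (- (\<gamma> - 1) * (u p * ux + v p * vx), - (\<gamma> - 1) * (u p * uy + v p * vy))"
    unfolding gderiv_def
    by (rule derivative_eq_intros u[unfolded gderiv_def] v[unfolded gderiv_def] refl | simp)+
       (auto simp: fun_eq_iff inner_prod_def field_simps)
  have "GDERIV (\<lambda>z. density \<gamma> ((u z)\<^sup>2 + (v z)\<^sup>2)) p :>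
      (e * R) *\<^sub>R (- (\<gamma> - 1) * (u p * ux + v p * vx), - (\<gamma> - 1) * (u p * uy + v p * vy))"
    unfolding density_def R_def e_def
    by (rule GDERIV_DERIV_compose[OF base has_real_derivative_powr[OF c2]])
  also have "(e * R) *\<^sub>R (- (\<gamma> - 1) * (u p * ux + v p * vx), - (\<gamma> - 1) * (u p * uy + v p * vy))
     = (- ((e * (\<gamma> - 1)) * R) * (u p * ux + v p * vx), - ((e * (\<gamma> - 1)) * R) * (u p * uy + v p * vy))"
    by (simp add: algebra_simps)
  finally have d: "GDERIV (\<lambda>z. density \<gamma> ((u z)\<^sup>2 + (v z)\<^sup>2)) p :>
      (- R * (u p * ux + v p * vx), - R * (u p * uy + v p * vy))"
    by (simp add: e)
  have "partial_x (\<lambda>z. density \<gamma> ((u z)\<^sup>2 + (v z)\<^sup>2) * u z) p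
      = ?c * R * ux - R * (u p * ux + v p * vx) * u p"
    using GDERIV_mult[OF d u] by (intro partials_of_GDERIV(1)) (simp add: \<rho> mult_ac)
  moreover have "partial_y (\<lambda>z. density \<gamma> ((u z)\<^sup>2 + (v z)\<^sup>2) * v z) p
      = ?c * R * vy - R * (u p * uy + v p * vy) * v p"
    using GDERIV_mult[OF d v] by (intro partials_of_GDERIV(2)) (simp add: \<rho> mult_ac)
  ultimately have "R * ((?c - (u p)\<^sup>2) * ux - u p * v p * (uy + vx) + (?c - (v p)\<^sup>2) * vy) = 0"
    using mass by (simp add: power2_eq_square algebra_simps)
  then show ?thesis using R by simp
qed

lemma gas_flow_of_C2_potential_flow:
  assumes flow: "C2_potential_flow \<gamma> \<Omega> u v" and \<gamma>: "\<gamma> > 1" and \<Omega>: "open \<Omega>"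
  shows "\<exists>ux uy vy uxx uxy uyy vyy. gas_flow \<gamma> \<Omega> u v ux uy vy uxx uxy uyy vyy"
proof -
  have C: "Ck_closure 2 \<Omega> u" "Ck_closure 2 \<Omega> v" using flow by (simp_all add: C2_potential_flow_def)
  from Ck_closure_2_derivatives[OF C(1) \<Omega>] obtain ux uy uxx uxy uyy where
    "\<forall>p\<in>\<Omega>. GDERIV u p :> (ux p, uy p) \<and> GDERIV ux p :> (uxx p, uxy p) \<and> GDERIV uy p :> (uxy p, uyy p)"
    by blast
  then have u: "\<And>p. p \<in> \<Omega> \<Longrightarrow> GDERIV u p :> (ux p, uy p)"
    "\<And>p. p \<in> \<Omega> \<Longrightarrow> GDERIV ux p :> (uxx p, uxy p)" "\<And>p. p \<in> \<Omega> \<Longrightarrow> GDERIV uy p :> (uxy p, uyy p)"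
    by blast+
  from Ck_closure_2_derivatives[OF C(2) \<Omega>] obtain vx vy vxx vxy vyy where
    "\<forall>p\<in>\<Omega>. GDERIV v p :> (vx p, vy p) \<and> GDERIV vx p :> (vxx p, vxy p) \<and> GDERIV vy p :> (vxy p, vyy p)"
    by blast
  then have v: "\<And>p. p \<in> \<Omega> \<Longrightarrow> GDERIV v p :> (vx p, vy p)"
    "\<And>p. p \<in> \<Omega> \<Longrightarrow> GDERIV vx p :> (vxx p, vxy p)" "\<And>p. p \<in> \<Omega> \<Longrightarrow> GDERIV vy p :> (vxy p, vyy p)"
    by blast+
  have irrot: "uy p = vx p" if "p \<in> \<Omega>" for p
    using flow that partials_of_GDERIV(2)[OF u(1)[OF that]] partials_of_GDERIV(1)[OF v(1)[OF that]]
    by (simp add: C2_potential_flow_def)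
  have vxy: "vxy p = uyy p" if "p \<in> \<Omega>" for p
    using GDERIV_unique_on_open[OF u(3)[OF that] v(2)[OF that] \<Omega> that irrot] by simp
  have vac: "0 < 1 - (\<gamma> - 1) / 2 * ((u p)\<^sup>2 + (v p)\<^sup>2)" if "p \<in> \<Omega>" for p
  proof -
    have "p \<in> closure \<Omega>" using that closure_subset by blast
    then have "speed u v p < q_max \<gamma>" using flow by (simp add: C2_potential_flow_def)
    then have "(u p)\<^sup>2 + (v p)\<^sup>2 < 2 / (\<gamma> - 1)" by (simp add: speed_def q_max_def)
    then show ?thesis using \<gamma> by (simp add: field_simps)
  qed
  have "potential_flow \<gamma> \<Omega> u v ux uy vy uxx uxy uyy vyy"
    using \<gamma> \<Omega> u v irrot vxy by unfold_locales auto
  then interpret potential_flow \<gamma> \<Omega> u v ux uy vy uxx uxy uyy vyy .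
  have "gas_flow \<gamma> \<Omega> u v ux uy vy uxx uxy uyy vyy"
  proof
    fix p assume p: "p \<in> \<Omega>"
    show "0 < c2 p" using vac[OF p] by (simp add: c2_def)
    have "partial_x (\<lambda>z. density \<gamma> ((u z)\<^sup>2 + (v z)\<^sup>2) * u z) p
            + partial_y (\<lambda>z. density \<gamma> ((u z)\<^sup>2 + (v z)\<^sup>2) * v z) p = 0"
      using flow p by (simp add: C2_potential_flow_def)
    from nondivergence_form[OF \<gamma> u(1)[OF p] v(1)[OF p] vac[OF p] this]
    show "A p * ux p + 2 * B p * uy p + C p * vy p = 0"
      using irrot[OF p] by (simp add: A_def B_def C_def c2_def algebra_simps)
  qed
  then show ?thesis by blast
qed

lemma open_nozzle_domain:
  assumes "de_laval_nozzle lm lp f f' g t"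
  shows "open (nozzle_domain lm lp f g t)"
proof -
  note n = assms[unfolded de_laval_nozzle_def]
  have "continuous_on {lm..lp} f" using n by (intro DERIV_continuous_on) auto
  then have "compact (upper_wall lm lp f)" unfolding upper_wall_def
    by (intro compact_continuous_image continuous_intros compact_Icc)
  moreover have "compact (axis_wall g t)" unfolding axis_wall_def
    by (intro compact_continuous_image continuous_intros compact_Icc)
  moreover have "compact (inlet lm f g)" unfolding inlet_def
    using n by (intro compact_continuous_image continuous_intros compact_Icc) auto
  moreover have "compact (outlet lp f t)" unfolding outlet_def
    using n by (intro compact_continuous_image continuous_intros compact_Icc) auto
  ultimately show ?thesis
    unfolding nozzle_domain_def by (intro open_inside compact_imp_closed compact_Un)
qed

lemma parallel_to_left_normal_iff:
  assumes "norm \<tau> = 1"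
  shows "(\<exists>c. w = c *\<^sub>R left_normal \<tau>) \<longleftrightarrow> w \<bullet> \<tau> = 0"
  using decompose_left_normal[OF assms, of w] by auto

text \<open>
  Used for the potential, which is known to be differentiable only at interior parameters.
\<close>

lemma constant_on_arc_iff:
  fixes k :: "real \<Rightarrow> real"
  assumes L: "0 < L" and k: "continuous_on {0..L} k"
    and d: "\<And>s. s \<in> {0<..<L} \<Longrightarrow> (k has_real_derivative d s) (at s)"
  shows "(\<forall>s\<in>{0..L}. k s = k 0) \<longleftrightarrow> (\<forall>s\<in>{0<..<L}. d s = 0)"
proof
  assume c: "\<forall>s\<in>{0..L}. k s = k 0"
  show "\<forall>s\<in>{0<..<L}. d s = 0"
  proof
    fix s assume s: "s \<in> {0<..<L}"
    have "k 0 = k r" if "r \<in> {0<..<L}" for r using c[rule_format, of r] that by simp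
    then have "(k has_real_derivative 0) (at s)"
      by (intro has_field_derivative_transform_within_open[OF DERIV_const[of "k 0"] _ s]) auto
    then show "d s = 0" using DERIV_unique[OF d[OF s]] by blast
  qed
next
  assume z: "\<forall>s\<in>{0<..<L}. d s = 0"
  show "\<forall>s\<in>{0..L}. k s = k 0"
  proof
    fix s assume s: "s \<in> {0..L}"
    show "k s = k 0"
    proof (rule DERIV_isconst2[OF L k])
      fix x assume "0 < x" "x < L"
      then show "(k has_real_derivative 0) (at x)" using d[of x] z by simp
    qed (use s in auto)
  qed
qed

lemma vanishes_on_closed_interval:
  fixes k :: "real \<Rightarrow> real"
  assumes "0 < L" "continuous_on {0..L} k" "\<And>s. s \<in> {0<..<L} \<Longrightarrow> k s = 0" "s \<in> {0..L}"
  shows "k s = 0"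
  using continuous_constant_on_closure[of "{0<..<L}" k 0 s] assms by simp

theorem proposition3p1:
  fixes \<gamma> lm lp L :: real
    and f f' g t :: "real \<Rightarrow> real"
    and u v \<theta> \<phi> :: "real \<times> real \<Rightarrow> real"
    and \<sigma> :: "real \<Rightarrow> real \<times> real"
    and \<Omega> :: "(real \<times> real) set"
  assumes "\<gamma> > 1"
    and "de_laval_nozzle lm lp f f' g t"
    and "\<Omega> = nozzle_domain lm lp f g t"
    and "C2_potential_flow \<gamma> \<Omega> u v"
    and "slip_condition lm lp f f' g t u v"
    and "flow_angle \<Omega> (upper_wall lm lp f \<union> axis_wall g t) u v \<theta>"
    and "velocity_potential \<Omega> u v \<phi>"
    and "meyer_sonic_curve \<gamma> lm lp f g t u v \<sigma> L"
  defines "i \<equiv> \<sigma> L = (0, f 0)"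
    and "ii \<equiv> \<forall>s\<in>{0..L}. \<theta> (\<sigma> s) = 0"
    and "iii \<equiv> \<forall>s\<in>{0..L}. exceptional_point \<theta> \<sigma> L s"
    and "iv \<equiv> \<forall>s\<in>{0..L}. \<exists>c. (u (\<sigma> s), v (\<sigma> s)) = c *\<^sub>R unit_normal \<sigma> L s"
    and "v' \<equiv> \<phi> constant_on (\<sigma> ` {0..L})"
    and "vi \<equiv> \<sigma> ` {0..L} = {0} \<times> {0..f 0}"
  shows "(i \<longleftrightarrow> ii) \<and> (i \<longleftrightarrow> iii) \<and> (i \<longleftrightarrow> iv) \<and> (i \<longleftrightarrow> v') \<and> (i \<longleftrightarrow> vi)"
proof -
  note \<gamma> = assms(1) and nozzle = assms(2)[unfolded de_laval_nozzle_def] and flow = assms(4)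
    and angle = assms(6)[unfolded flow_angle_def] and potential = assms(7)[unfolded velocity_potential_def]
    and slip = assms(5)[unfolded slip_condition_def]
  have open_\<Omega>: "open \<Omega>" using open_nozzle_domain[OF assms(2)] assms(3) by simp
  define Sm where "Sm = subsonic_region \<gamma> \<Omega> u v"
  define Sp where "Sp = supersonic_region \<gamma> \<Omega> u v"
  have arc: "regular_C2_arc \<sigma> L" and ends: "\<sigma> 0 \<in> axis_wall g t" "\<sigma> L \<in> upper_wall lm lp f"
    and sonic_set: "\<sigma> ` {0<..<L} = sonic_set \<gamma> \<Omega> u v"
    and frontiers: "\<sigma> ` {0..L} \<subseteq> frontier Sm \<inter> frontier Sp"
    using assms(8) unfolding meyer_sonic_curve_def Let_def assms(3)[symmetric] Sm_def Sp_def by blast+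
  obtain \<sigma>' \<sigma>'' where \<sigma>: "0 < L" "inj_on \<sigma> {0..L}"
    "\<And>s. s \<in> {0..L} \<Longrightarrow> (\<sigma> has_vector_derivative \<sigma>' s) (at s within {0..L})"
    "\<And>s. s \<in> {0..L} \<Longrightarrow> (\<sigma>' has_vector_derivative \<sigma>'' s) (at s within {0..L})"
    "\<And>s. s \<in> {0..L} \<Longrightarrow> norm (\<sigma>' s) = 1" "continuous_on {0..L} \<sigma>''"
    using arc unfolding regular_C2_arc_def by blast
  have cont': "continuous_on {0..L} \<sigma>'"
    by (meson \<sigma>(4) continuous_on_eq_continuous_within has_vector_derivative_continuous)
  interpret C2_arc \<sigma> \<sigma>' L \<sigma>''
    by unfold_locales (fact \<sigma> cont')+
  obtain ux uy vy uxx uxy uyy vyy where "gas_flow \<gamma> \<Omega> u v ux uy vy uxx uxy uyy vyy"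
    using gas_flow_of_C2_potential_flow[OF flow \<gamma> open_\<Omega>] by blast
  then interpret gas_flow \<gamma> \<Omega> u v ux uy vy uxx uxy uyy vyy .
  have critical: "c_star \<gamma> = sqrt (2 / (\<gamma> + 1))" by (simp add: c_star_def)
  have regions: "Sm = {p \<in> \<Omega>. excess p < 0}" "Sp = {p \<in> \<Omega>. excess p > 0}"
    "sonic_set \<gamma> \<Omega> u v = {p \<in> \<Omega>. excess p = 0}"
    by (auto simp: Sm_def Sp_def subsonic_region_def supersonic_region_def sonic_set_def
        excess_def speed_def critical)
  have "level_arc \<sigma> \<sigma>' L \<Omega> excess"
  proof
    show "\<sigma> ` {0<..<L} = {p \<in> \<Omega>. excess p = 0}" using sonic_set regions by simp
    have "\<sigma> ` {0<..<L} \<subseteq> frontier Sm \<inter> frontier Sp" using frontiers by force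
    then show "\<sigma> ` {0<..<L} \<subseteq> closure {p \<in> \<Omega>. excess p < 0} \<inter> closure {p \<in> \<Omega>. 0 < excess p}"
      unfolding regions frontier_def by blast
  qed (fact open_\<Omega> continuous_coeffs)+
  then interpret level_arc \<sigma> \<sigma>' L \<Omega> excess .
  interpret sonic_arc \<sigma> \<sigma>' \<sigma>'' L \<gamma> \<Omega> u v ux uy vy uxx uxy uyy vyy ..
  have in_closure: "\<sigma> s \<in> closure \<Omega>" if "s \<in> {0..L}" for s
  proof -
    have "\<sigma> s \<in> closure Sm" using frontiers that unfolding frontier_def by blast
    moreover have "Sm \<subseteq> \<Omega>" by (auto simp: regions)
    ultimately show ?thesis using closure_mono by blast
  qed
  have cont_uv: "continuous_on (closure \<Omega>) u" "continuous_on (closure \<Omega>) v"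
    using flow unfolding C2_potential_flow_def numeral_2_eq_2 Ck_closure.simps by blast+
  have along: "continuous_on {0..L} (\<lambda>s. k (\<sigma> s))" if "continuous_on (closure \<Omega>) k" for k :: "real \<times> real \<Rightarrow> real"
    by (rule continuous_on_compose2[OF that cont]) (use in_closure in auto)
  \<comment> \<open>the endpoints are not in \<open>\<Omega>\<close>, but the velocity extends continuously to them\<close>
  have excess_0: "excess (\<sigma> s) = 0" if "s \<in> {0..L}" for s
    by (rule vanishes_on_closed_interval[OF L_pos _ sonic(2) that])
       (auto simp: excess_def intro!: continuous_intros along cont_uv)
  have speed: "speed u v (\<sigma> s) = sqrt (2 / (\<gamma> + 1))" if "s \<in> {0..L}" for s
    using excess_0[OF that] by (simp add: speed_def excess_def)
  interpret sonic_arc_angle \<sigma> \<sigma>' \<sigma>'' L \<gamma> \<Omega> u v ux uy vy uxx uxy uyy vyy \<theta>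
  proof
    show "continuous_on {0..L} (\<lambda>s. \<theta> (\<sigma> s))" using along angle by blast
    show "(u (\<sigma> s), v (\<sigma> s)) = sqrt (2 / (\<gamma> + 1)) *\<^sub>R (cos (\<theta> (\<sigma> s)), sin (\<theta> (\<sigma> s)))"
      if "s \<in> {0..L}" for s
      using angle in_closure[OF that] speed[OF that] by auto
  qed
  have L0: "0 \<in> {0..L}" "L \<in> {0..L}" using L_pos by auto
  have zero_if: "\<theta> (\<sigma> s) = 0" if "s \<in> {0..L}" "\<sigma> s \<in> upper_wall lm lp f \<union> axis_wall g t" "v (\<sigma> s) = 0" for s
  proof -
    have "sin (\<theta> (\<sigma> s)) = 0" using polar[OF that(1)] that(3) critical_speed_pos by simp
    moreover have "\<bar>\<theta> (\<sigma> s)\<bar> < pi / 2" using angle that(2) by blast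
    ultimately show ?thesis using sin_eq_0_pi[of "\<theta> (\<sigma> s)"] by auto
  qed
  have angle_0: "\<theta> (\<sigma> 0) = 0" using zero_if[OF L0(1)] ends(1) slip by blast
  obtain xL where xL: "xL \<in> {lm..lp}" "\<sigma> L = (xL, f xL)" using ends(2) by (auto simp: upper_wall_def)
  obtain x0 where x0: "\<sigma> 0 = (x0, 0)" using ends(1) by (auto simp: axis_wall_def)

  have i_ii: "i \<longleftrightarrow> ii"
  proof
    assume i
    then have "xL = 0" using xL by (simp add: i_def)
    then have "v (\<sigma> L) = 0" using slip nozzle xL by auto
    then have "\<theta> (\<sigma> L) = 0" using zero_if[OF L0(2)] ends(2) by blast
    then show ii unfolding ii_def using angle_zero_if_ends_zero[OF angle_0] by blast
  next
    assume ii
    then have "\<theta> (\<sigma> L) = 0" using L0 by (simp add: ii_def)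
    from velocity_if_angle_zero[OF L0(2) this] have "f' xL = 0"
      using slip xL critical_speed_pos by auto
    then have "xL = 0" using nozzle xL(1)
      by (metis atLeastAtMost_iff atLeastLessThan_iff greaterThanAtMost_iff less_irrefl linorder_neqE_linordered_idom)
    then show i using xL by (simp add: i_def)
  qed

  have ii_iii: "ii \<longleftrightarrow> iii"
  proof
    assume ii
    show iii unfolding iii_def exceptional_point_def
    proof
      fix s assume s: "s \<in> {0..L}"
      show "((\<lambda>r. \<theta> (\<sigma> r)) has_real_derivative 0) (at s within {0..L})"
        by (rule has_field_derivative_transform_within[OF DERIV_const[of 0], of 1])
           (use s \<open>ii\<close> in \<open>auto simp: ii_def\<close>)
    qed
  next
    assume iii
    have "\<theta> (\<sigma> s) = \<theta> (\<sigma> 0)" if "s \<in> {0..L}" for s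
    proof (rule DERIV_isconst2[OF L_pos cont_angle])
      fix x assume x: "0 < x" "x < L"
      then have "((\<lambda>r. \<theta> (\<sigma> r)) has_real_derivative 0) (at x within {0..L})"
        using \<open>iii\<close> by (simp add: iii_def exceptional_point_def)
      then show "((\<lambda>r. \<theta> (\<sigma> r)) has_real_derivative 0) (at x)" using x by (simp add: at_within_Icc_at)
    qed (use that in auto)
    then show ii using angle_0 by (simp add: ii_def)
  qed

  have normal: "unit_normal \<sigma> L s = \<nu> s" if "s \<in> {0..L}" for s
    using vector_derivative_within_closed_interval[OF L_pos that deriv[OF that]]
    by (simp add: unit_normal_def left_normal_def Let_def)
  have iv_closed: "iv \<longleftrightarrow> (\<forall>s\<in>{0..L}. (u (\<sigma> s), v (\<sigma> s)) \<bullet> \<sigma>' s = 0)"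
    unfolding iv_def using normal parallel_to_left_normal_iff[OF unit] by simp
  have iv_open: "iv \<longleftrightarrow> (\<forall>s\<in>{0<..<L}. (u (\<sigma> s), v (\<sigma> s)) \<bullet> \<sigma>' s = 0)"
  proof -
    have "continuous_on {0..L} (\<lambda>s. (u (\<sigma> s), v (\<sigma> s)) \<bullet> \<sigma>' s)"
      by (intro continuous_intros along cont_uv cont_tangent)
    from vanishes_on_closed_interval[OF L_pos this] show ?thesis
      unfolding iv_closed by auto
  qed

  have ii_iv: "ii \<longleftrightarrow> iv"
  proof
    assume ii
    then show iv
      using velocity_if_angle_zero(2) tangent_vertical_if_angle_zero
      unfolding ii_def iv_closed by (simp add: inner_prod_def)
  next
    assume iv
    then show ii
      using angle_constant_if_normal angle_0 unfolding ii_def iv_open by simp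
  qed

  have iv_v: "iv \<longleftrightarrow> v'"
  proof -
    have "((\<lambda>r. \<phi> (\<sigma> r)) has_real_derivative (u (\<sigma> s), v (\<sigma> s)) \<bullet> \<sigma>' s) (at s)" if "s \<in> {0<..<L}" for s
      using potential sonic(1)[OF that] by (intro GDERIV_along_curve deriv_interior that) blast
    from constant_on_arc_iff[OF L_pos along this]
    have "iv \<longleftrightarrow> (\<forall>s\<in>{0..L}. \<phi> (\<sigma> s) = \<phi> (\<sigma> 0))" using potential iv_open by blast
    also have "\<dots> \<longleftrightarrow> v'" using L0 by (auto simp: v'_def constant_on_def)
    finally show ?thesis .
  qed

  \<comment> \<open>under (i) the tangent is vertical, so the first coordinate vanishes on the curve and the second
      is injective along it\<close>
  have i_vi: "i \<longleftrightarrow> vi"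
  proof
    assume i
    then have ii using i_ii by simp
    have vertical: "fst (\<sigma> s) = fst (\<sigma> 0)" if "s \<in> {0..L}" for s
    proof (rule DERIV_isconst2[OF L_pos])
      show "continuous_on {0..L} (\<lambda>s. fst (\<sigma> s))" by (intro continuous_intros cont)
      fix x assume "0 < x" "x < L"
      then have x: "x \<in> {0<..<L}" "x \<in> {0..L}" by auto
      have "((\<lambda>s. fst (\<sigma> s)) has_vector_derivative fst (\<sigma>' x)) (at x)"
        using deriv_interior[OF x(1)]
        by (auto simp: has_vector_derivative_def intro!: derivative_eq_intros)
      moreover have "fst (\<sigma>' x) = 0"
        using tangent_vertical_if_angle_zero[OF _ x(2)] \<open>ii\<close> by (simp add: ii_def)
      ultimately show "((\<lambda>s. fst (\<sigma> s)) has_real_derivative 0) (at x)"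
        by (simp add: has_real_derivative_iff_has_vector_derivative)
    qed (use that in auto)
    have "fst (\<sigma> L) = 0" using \<open>i\<close> by (simp add: i_def)
    then have fst0: "fst (\<sigma> s) = 0" if "s \<in> {0..L}" for s
      using vertical[OF that] vertical[OF L0(2)] by simp
    have seg: "closed_segment 0 L = {0..L}" using L_pos by (simp add: closed_segment_eq_real_ivl)
    have "f 0 > 0" using nozzle by auto
    have "inj_on (\<lambda>s. snd (\<sigma> s)) (closed_segment 0 L)"
    proof (rule inj_onI)
      fix a b assume ab: "a \<in> closed_segment 0 L" "b \<in> closed_segment 0 L" "snd (\<sigma> a) = snd (\<sigma> b)"
      have L: "a \<in> {0..L}" "b \<in> {0..L}" using ab seg by blast+
      have "\<sigma> a = \<sigma> b" using fst0[OF L(1)] fst0[OF L(2)] ab(3) by (simp add: prod_eq_iff)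
      then show "a = b" using L by (rule inj_onD[OF inj])
    qed
    moreover have "continuous_on (closed_segment 0 L) (\<lambda>s. snd (\<sigma> s))"
      unfolding seg by (intro continuous_intros cont)
    ultimately have "(\<lambda>s. snd (\<sigma> s)) ` closed_segment 0 L = closed_segment (snd (\<sigma> 0)) (snd (\<sigma> L))"
      by (intro continuous_injective_image_segment_1)
    then have snd_image: "(\<lambda>s. snd (\<sigma> s)) ` {0..L} = {0..f 0}"
      unfolding seg using \<open>i\<close> x0 \<open>f 0 > 0\<close> by (simp add: i_def closed_segment_eq_real_ivl)
    show vi unfolding vi_def
    proof (intro equalityI subsetI)
      fix p assume "p \<in> \<sigma> ` {0..L}"
      then obtain s where s: "s \<in> {0..L}" "p = \<sigma> s" by blast
      then have "snd p \<in> {0..f 0}" using snd_image by blast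
      then show "p \<in> {0} \<times> {0..f 0}" using fst0[OF s(1)] s(2) by (simp add: mem_Times_iff)
    next
      fix p :: "real \<times> real" assume p: "p \<in> {0} \<times> {0..f 0}"
      then have "snd p \<in> (\<lambda>s. snd (\<sigma> s)) ` {0..L}" using snd_image by auto
      then obtain s where s: "s \<in> {0..L}" "snd p = snd (\<sigma> s)" by blast
      then have "p = \<sigma> s" using fst0[OF s(1)] p by (auto simp: prod_eq_iff)
      then show "p \<in> \<sigma> ` {0..L}" using s by blast
    qed
  next
    assume vi
    moreover have "\<sigma> L \<in> \<sigma> ` {0..L}" using L0 by blast
    ultimately have "\<sigma> L \<in> {0} \<times> {0..f 0}" unfolding vi_def by (simp only:)
    then show i using xL by (auto simp: i_def)
  qed
  show ?thesis using i_ii ii_iii ii_iv iv_v i_vi by blast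
qed

end
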